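(* For all $k\ge2$, $\mathsf{SRT}^2_k\le_W\mathrm{Ind}\,\mathscr{E}_k\le_W\mathsf{RT}^2_k$. Moreover, $\mathsf{RT}^2_2\not\le_c\mathrm{Ind}\,\mathscr{E}_\mathbb{N}$ and $\mathrm{Ind}\,\mathscr{E}_2\not\le_W\mathsf{SRT}^2_\mathbb{N}$.
   Context: A problem is a partial multivalued function $P\colon\subseteq\mathbb{N}^\mathbb{N}\rightrightarrows\mathbb{N}^\mathbb{N}$. $P\le_W Q$ means there are Turing functionals $\Delta,\Psi$ with $\Delta^p\in\mathrm{dom}\,Q$ for all $p\in\mathrm{dom}\,P$ and $\Psi^{p\oplus q}\in P(p)$ for all $q\in Q(\Delta^p)$. $P\le_c Q$ (computable reducibility) means every $p\in\mathrm{dom}\,P$ computes some $x\in\mathrm{dom}\,Q$ such that for every $q\in Q(x)$, $p\oplus q$ computes an element of $P(p)$. $\mathscr{E}$ is the countable equivalence relation: the structure with one binary relation that is an equivalence relation with countably infinitely many classes, each countably infinite; a fixed computable copy has domain $\mathbb{N}\times\mathbb{N}$ with $(x,y)\sim(x',y')$ iff $x=x'$. $\mathrm{Ind}\,\mathscr{E}_k$: instances are pairs $\langle\mathcal{A},c\rangle$ with $\mathcal{A}$ a presentation of $\mathscr{E}$ and $c\colon\mathrm{dom}\,\mathcal{A}\to\{0,\dots,k-1\}$; solutions are $c$-monochromatic sets $B$ whose induced substructure is isomorphic to $\mathscr{E}$ (i.e. $B$ meets infinitely many classes in infinitely many points each). $\mathrm{Ind}\,\mathscr{E}_\mathbb{N}$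 is the same but $c$ is any coloring with finite range, the number of colors not given. $\mathsf{RT}^2_k$: instances are $c\colon[\mathbb{N}]^2\to\{0,\dots,k-1\}$; solutions are infinite sets $H$ with $c$ constant on $[H]^2$. $\mathsf{SRT}^2_k$ is the restriction of $\mathsf{RT}^2_k$ to stable colorings, i.e. those with $\lim_m c\{n,m\}$ existing for every $n$. $\mathsf{SRT}^2_\mathbb{N}$ has instances the stable colorings $c\colon[\mathbb{N}]^2\to k$ for some $k$ (not given), with the same solutions. *)

theory Defs
  imports Complex_Main "HOL-Library.Ramsey" "HOL-Library.Nat_Bijection" "HOL-Library.Countable_Set"
    "HOL-Library.Indicator_Function"
begin

section \<open>Computation relative to an oracle\<close>

text \<open>
  Turing functionals are given by Kleene's \<open>\<mu>\<close>-recursive functions with an oracle: programs are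
  built from the usual initial functions together with the oracle itself.  Programs are not typed
  by arity; a program applied to a list of unsuitable length may be undefined, which adds
  nothing to the class of functionals.
\<close>

datatype program =
    Zero
  | Succ
  | Proj nat
  | Oracle
  | Comp program "program list"
  | PrimRec program program
  | Mu program

text \<open>\<open>eval p e xs y\<close>: the program \<open>e\<close> with oracle \<open>p\<close> halts on the arguments \<open>xs\<close> with output \<open>y\<close>.\<close>

inductive eval :: "(nat \<Rightarrow> nat) \<Rightarrow> program \<Rightarrow> nat list \<Rightarrow> nat \<Rightarrow> bool" for p where
  eval_Zero: "eval p Zero xs 0"
| eval_Succ: "eval p Succ [x] (Suc x)"
| eval_Proj: "i < length xs \<Longrightarrow> eval p (Proj i) xs (xs ! i)"
| eval_Oracle: "eval p Oracle [x] (p x)"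
| eval_Comp: "list_all2 (\<lambda>g y. eval p g xs y) gs ys \<Longrightarrow> eval p f ys z \<Longrightarrow> eval p (Comp f gs) xs z"
| eval_PrimRec_0: "eval p f xs y \<Longrightarrow> eval p (PrimRec f g) (0 # xs) y"
| eval_PrimRec_Suc:
    "eval p (PrimRec f g) (n # xs) y \<Longrightarrow> eval p g (n # y # xs) z \<Longrightarrow> eval p (PrimRec f g) (Suc n # xs) z"
| eval_Mu: "eval p f (n # xs) 0 \<Longrightarrow> (\<forall>m<n. \<exists>y. eval p f (m # xs) (Suc y)) \<Longrightarrow> eval p (Mu f) xs n"

inductive_cases eval_elims:
  "eval p Zero xs y" "eval p Succ xs y" "eval p (Proj i) xs y" "eval p Oracle xs y"
  "eval p (Comp f gs) xs y" "eval p (PrimRec f g) (0 # xs) y"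
  "eval p (PrimRec f g) (Suc n # xs) y" "eval p (Mu f) xs y"

lemma eval_deterministic: "eval p e xs y \<Longrightarrow> eval p e xs y' \<Longrightarrow> y = y'"
proof (induction arbitrary: y' rule: eval.induct)
  case (eval_Zero xs)
  then show ?case by (rule eval_elims(1)) simp
next
  case (eval_Succ x)
  then show ?case by (rule eval_elims(2)) simp
next
  case (eval_Proj i xs)
  from eval_Proj(2) show ?case by (rule eval_elims(3)) simp
next
  case (eval_Oracle x)
  then show ?case by (rule eval_elims(4)) simp
next
  case (eval_Comp xs gs ys f z)
  from eval_Comp.prems obtain ys' where
    ys': "list_all2 (\<lambda>g y. eval p g xs y) gs ys'" and z: "eval p f ys' y'"
    by (rule eval_elims(5))
  have "ys = ys'"
  proof (rule nth_equalityI)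
    show "length ys = length ys'"
      using list_all2_lengthD[OF eval_Comp.IH(1)] list_all2_lengthD[OF ys'] by (rule trans[OF sym])
    show "ys ! i = ys' ! i" if "i < length ys" for i
    proof -
      have "i < length gs" using that list_all2_lengthD[OF eval_Comp.IH(1)] by simp
      then show ?thesis
        using list_all2_nthD[OF eval_Comp.IH(1)] list_all2_nthD[OF ys'] by blast
    qed
  qed
  with z eval_Comp.IH(2) show ?case by blast
next
  case (eval_PrimRec_0 f xs y g)
  from eval_PrimRec_0.prems have "eval p f xs y'" by (rule eval_elims(6))
  then show ?case by (rule eval_PrimRec_0.IH)
next
  case (eval_PrimRec_Suc f g n xs y z)
  from eval_PrimRec_Suc.prems obtain w where
    "eval p (PrimRec f g) (n # xs) w" and w: "eval p g (n # w # xs) y'"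
    by (rule eval_elims(7))
  then have "y = w" by (intro eval_PrimRec_Suc.IH(1))
  with w show ?case by (intro eval_PrimRec_Suc.IH(2)) simp
next
  case (eval_Mu f n xs)
  from eval_Mu.prems obtain
    z: "eval p f (y' # xs) 0" and nz: "\<forall>m<y'. \<exists>y. eval p f (m # xs) (Suc y)"
    by (rule eval_elims(8))
  have "\<not> n < y'" using nz eval_Mu.IH(1) by (metis nat.distinct(1))
  moreover have "\<not> y' < n" using z eval_Mu.IH(2) by (metis nat.distinct(1))
  ultimately show ?case by simp
qed

text \<open>\<open>functional e p x\<close>: the Turing functional with program \<open>e\<close> is total on the oracle \<open>p\<close>
  and its value there is \<open>x\<close>, i.e. \<open>\<Phi>\<^sub>e\<^sup>p = x\<close>.\<close>

definition functional :: "program \<Rightarrow> (nat \<Rightarrow> nat) \<Rightarrow> (nat \<Rightarrow> nat) \<Rightarrow> bool" where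
  "functional e p x \<longleftrightarrow> (\<forall>n. eval p e [n] (x n))"

lemma functional_unique: "functional e p x \<Longrightarrow> functional e p x' \<Longrightarrow> x = x'"
  unfolding functional_def by (blast intro: eval_deterministic)

definition computes :: "(nat \<Rightarrow> nat) \<Rightarrow> (nat \<Rightarrow> nat) \<Rightarrow> bool" where
  "computes p x \<longleftrightarrow> (\<exists>e. functional e p x)"

definition join :: "(nat \<Rightarrow> nat) \<Rightarrow> (nat \<Rightarrow> nat) \<Rightarrow> nat \<Rightarrow> nat" (infixr \<open>\<oplus>\<^sub>J\<close> 65) where
  "(p \<oplus>\<^sub>J q) n = (if even n then p (n div 2) else q (n div 2))"


section \<open>Problems and reducibilities\<close>

text \<open>A partial multivalued function on Baire space is a relation; \<^term>\<open>Domain P\<close> is its domain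
  and \<^term>\<open>P `` {p}\<close> is the set of its values at \<open>p\<close>.\<close>

type_synonym problem = "((nat \<Rightarrow> nat) \<times> (nat \<Rightarrow> nat)) set"

definition weihrauch_le :: "problem \<Rightarrow> problem \<Rightarrow> bool" (infix \<open>\<le>\<^sub>W\<close> 50) where
  "P \<le>\<^sub>W Q \<longleftrightarrow> (\<exists>\<Delta> \<Psi>. \<forall>p\<in>Domain P. \<exists>x\<in>Domain Q. functional \<Delta> p x \<and>
      (\<forall>q\<in>Q `` {x}. \<exists>y\<in>P `` {p}. functional \<Psi> (p \<oplus>\<^sub>J q) y))"

definition computable_le :: "problem \<Rightarrow> problem \<Rightarrow> bool" (infix \<open>\<le>\<^sub>c\<close> 50) where
  "P \<le>\<^sub>c Q \<longleftrightarrow> (\<forall>p\<in>Domain P. \<exists>x\<in>Domain Q. computes p x \<and>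
      (\<forall>q\<in>Q `` {x}. \<exists>y\<in>P `` {p}. computes (p \<oplus>\<^sub>J q) y))"


section \<open>Ramsey's theorem for pairs\<close>

text \<open>Pairs \<open>i < m\<close> correspond bijectively to the codes \<^term>\<open>prod_encode (i, m - Suc i)\<close>.
  Subsets of the natural numbers are named by their characteristic functions.\<close>

definition coloring_name :: "(nat set \<Rightarrow> nat) \<Rightarrow> nat \<Rightarrow> nat" where
  "coloring_name c n = (case prod_decode n of (i, j) \<Rightarrow> c {i, Suc (i + j)})"

definition homogeneous :: "(nat set \<Rightarrow> nat) \<Rightarrow> nat set \<Rightarrow> bool" where
  "homogeneous c H \<longleftrightarrow> (\<exists>i. \<forall>e\<in>[H]\<^bsup>2\<^esup>. c e = i)"

text \<open>Convergence is with respect to the discrete topology on the natural numbers; the junk value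
  \<open>c {n, n}\<close> does not influence the limit.\<close>

definition stable_coloring :: "(nat set \<Rightarrow> nat) \<Rightarrow> bool" where
  "stable_coloring c \<longleftrightarrow> (\<forall>n. convergent (\<lambda>m. c {n, m}))"

definition RT2 :: "nat \<Rightarrow> problem" where
  "RT2 k = {(coloring_name c, indicator H) | c H.
     c \<in> [UNIV]\<^bsup>2\<^esup> \<rightarrow> {..<k} \<and> infinite H \<and> homogeneous c H}"

definition SRT2 :: "nat \<Rightarrow> problem" where
  "SRT2 k = {(coloring_name c, indicator H) | c H.
     c \<in> [UNIV]\<^bsup>2\<^esup> \<rightarrow> {..<k} \<and> stable_coloring c \<and> infinite H \<and> homogeneous c H}"

definition SRT2_N :: problem where
  "SRT2_N = {(coloring_name c, indicator H) | c H.
     (\<exists>k. c \<in> [UNIV]\<^bsup>2\<^esup> \<rightarrow> {..<k}) \<and> stable_coloring c \<and> infinite H \<and> homogeneous c H}"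


section \<open>Indivisibility of the countable equivalence relation\<close>

text \<open>Isomorphism of structures with one binary relation.\<close>

definition isomorphic :: "'a set \<Rightarrow> ('a \<times> 'a) set \<Rightarrow> 'b set \<Rightarrow> ('b \<times> 'b) set \<Rightarrow> bool" where
  "isomorphic A R B S \<longleftrightarrow>
     (\<exists>f. bij_betw f A B \<and> (\<forall>x\<in>A. \<forall>y\<in>A. (x, y) \<in> R \<longleftrightarrow> (f x, f y) \<in> S))"

text \<open>The standard copy of the structure has domain \<^typ>\<open>nat \<times> nat\<close>.\<close>

definition E_rel :: "((nat \<times> nat) \<times> (nat \<times> nat)) set" where
  "E_rel = {((x, y), (x', y')) | x y x' y'. x = x'}"

text \<open>Presentations may have any set \<open>D\<close> of natural numbers as their domain.\<close>

definition presentation_E :: "nat set \<Rightarrow> (nat \<times> nat) set \<Rightarrow> bool" where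
  "presentation_E D R \<longleftrightarrow> R \<subseteq> D \<times> D \<and> isomorphic D R UNIV E_rel"

definition mono_copy_E :: "nat set \<Rightarrow> (nat \<times> nat) set \<Rightarrow> (nat \<Rightarrow> nat) \<Rightarrow> nat set \<Rightarrow> bool" where
  "mono_copy_E D R c B \<longleftrightarrow>
     B \<subseteq> D \<and> (\<exists>i. \<forall>x\<in>B. c x = i) \<and> isomorphic B (R \<inter> B \<times> B) UNIV E_rel"

text \<open>A coloring of \<open>D\<close> is represented by any total function extending it.\<close>

definition instance_name :: "nat set \<Rightarrow> (nat \<times> nat) set \<Rightarrow> (nat \<Rightarrow> nat) \<Rightarrow> nat \<Rightarrow> nat" where
  "instance_name D R c = (indicator D \<oplus>\<^sub>J indicator (prod_encode ` R)) \<oplus>\<^sub>J c"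

definition Ind_E :: "nat \<Rightarrow> problem" where
  "Ind_E k = {(instance_name D R c, indicator B) | D R c B.
     presentation_E D R \<and> c \<in> D \<rightarrow> {..<k} \<and> mono_copy_E D R c B}"

definition Ind_E_N :: problem where
  "Ind_E_N = {(instance_name D R c, indicator B) | D R c B.
     presentation_E D R \<and> finite (c ` D) \<and> mono_copy_E D R c B}"


section \<open>Every instance has a solution\<close>

text \<open>Hence the domains of the relations above consist of all the intended instances.\<close>

lemma homogeneous_exists:
  assumes "c \<in> [UNIV]\<^bsup>2\<^esup> \<rightarrow> {..<k}"
  shows "\<exists>H. infinite H \<and> homogeneous c H"
proof -
  have "\<forall>X. X \<subseteq> (UNIV :: nat set) \<and> finite X \<and> card X = 2 \<longrightarrow> c X < k"
    using assms by (auto simp: nsets_def)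
  from Ramsey[OF infinite_UNIV_nat this] obtain H i where
    H: "infinite H" "\<forall>X. X \<subseteq> H \<and> finite X \<and> card X = 2 \<longrightarrow> c X = i"
    by (elim exE conjE) (rule that)
  from H(2) have "homogeneous c H" unfolding homogeneous_def nsets_def by simp
  with H(1) show ?thesis by blast
qed

lemma mono_copy_E_exists:
  assumes pres: "presentation_E D R" and fin: "finite (c ` D)"
  shows "\<exists>B. mono_copy_E D R c B"
proof -
  from pres obtain f where f: "bij_betw f D UNIV"
    and R': "\<forall>x\<in>D. \<forall>y\<in>D. (x, y) \<in> R \<longleftrightarrow> (f x, f y) \<in> E_rel"
    unfolding presentation_E_def isomorphic_def by blast
  have E: "(a, b) \<in> E_rel \<longleftrightarrow> fst a = fst b" for a b
    unfolding E_rel_def by (cases a; cases b) auto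
  have R: "(x, y) \<in> R \<longleftrightarrow> fst (f x) = fst (f y)" if "x \<in> D" "y \<in> D" for x y
    using R' that E by blast
  define g where "g = inv_into D f"
  have g: "g z \<in> D" "f (g z) = z" for z
    using f unfolding g_def bij_betw_def by (auto intro: inv_into_into f_inv_into_f)
  have gf: "g (f d) = d" if "d \<in> D" for d
    using f that unfolding g_def bij_betw_def by simp
  have "\<exists>i\<in>c ` D. infinite {y. c (g (x, y)) = i}" for x
  proof -
    have "finite (range (\<lambda>y. c (g (x, y))))"
      by (rule finite_subset[OF _ fin]) (use g in auto)
    from inf_img_fin_dom[OF this infinite_UNIV_nat] show ?thesis
      using g by (auto simp: vimage_def)
  qed
  then obtain I where I: "\<And>x. I x \<in> c ` D" "\<And>x. infinite {y. c (g (x, y)) = I x}"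
    by metis
  have "finite (range I)"
    by (rule finite_subset[OF _ fin]) (use I in auto)
  from inf_img_fin_dom[OF this infinite_UNIV_nat] obtain i where
    X: "infinite {x. I x = i}" by (auto simp: vimage_def)
  define X where "X = {x. I x = i}"
  define Y where "Y x = {y. c (g (x, y)) = i}" for x
  define B where "B = {d \<in> D. fst (f d) \<in> X \<and> c d = i}"
  define t where "t = to_nat_on X"
  define s where "s x = to_nat_on (Y x)" for x
  have t: "bij_betw t X UNIV"
    unfolding t_def using X by (intro to_nat_on_infinite) (auto simp: X_def)
  have s: "bij_betw (s x) (Y x) UNIV" if "x \<in> X" for x
    unfolding s_def using that I(2)[of x]
    by (intro to_nat_on_infinite) (auto simp: X_def Y_def)
  have BY: "snd (f d) \<in> Y (fst (f d))" if "d \<in> B" for d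
    using that gf unfolding Y_def B_def by simp
  define h where "h d = (t (fst (f d)), s (fst (f d)) (snd (f d)))" for d
  have "inj_on h B"
  proof (rule inj_onI)
    fix d d' assume d: "d \<in> B" "d' \<in> B" and eq: "h d = h d'"
    have 1: "fst (f d) = fst (f d')"
      using eq d t unfolding h_def bij_betw_def B_def by (auto dest: inj_onD)
    have "fst (f d) \<in> X" using d by (simp add: B_def)
    with s have "inj_on (s (fst (f d))) (Y (fst (f d)))" by (simp add: bij_betw_def)
    then have "snd (f d) = snd (f d')"
      using eq BY[OF d(1)] BY[OF d(2)] 1 unfolding h_def by (auto dest: inj_onD)
    with 1 have "f d = f d'" by (simp add: prod_eq_iff)
    with d f show "d = d'" unfolding B_def bij_betw_def by (auto dest: inj_onD)
  qed
  moreover have "h ` B = UNIV"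
  proof -
    have "(a, b) \<in> h ` B" for a b
    proof -
      obtain x where x: "x \<in> X" "t x = a" using t unfolding bij_betw_def by (metis UNIV_I imageE)
      obtain y where y: "y \<in> Y x" "s x y = b"
        using s[OF x(1)] unfolding bij_betw_def by (metis UNIV_I imageE)
      have "g (x, y) \<in> B" using x y g unfolding B_def Y_def by simp
      moreover have "h (g (x, y)) = (a, b)" using x y g unfolding h_def by simp
      ultimately show ?thesis by force
    qed
    then show ?thesis by auto
  qed
  ultimately have "bij_betw h B UNIV" by (simp add: bij_betw_def)
  moreover have "(x, y) \<in> R \<inter> B \<times> B \<longleftrightarrow> (h x, h y) \<in> E_rel" if "x \<in> B" "y \<in> B" for x y
    using that R[of x y] t unfolding E h_def bij_betw_def B_def by (auto dest: inj_onD)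
  ultimately have "isomorphic B (R \<inter> B \<times> B) UNIV E_rel"
    unfolding isomorphic_def by blast
  then have "mono_copy_E D R c B" unfolding mono_copy_E_def B_def by auto
  then show ?thesis ..
qed

lemma Domain_RT2: "Domain (RT2 k) = {coloring_name c | c. c \<in> [UNIV]\<^bsup>2\<^esup> \<rightarrow> {..<k}}"
proof (intro set_eqI iffI)
  fix p assume "p \<in> Domain (RT2 k)"
  then show "p \<in> {coloring_name c | c. c \<in> [UNIV]\<^bsup>2\<^esup> \<rightarrow> {..<k}}"
    unfolding RT2_def by (elim DomainE CollectE exE conjE Pair_inject) blast
next
  fix p assume "p \<in> {coloring_name c | c. c \<in> [UNIV]\<^bsup>2\<^esup> \<rightarrow> {..<k}}"
  then obtain c where c: "p = coloring_name c" "c \<in> [UNIV]\<^bsup>2\<^esup> \<rightarrow> {..<k}" by blast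
  then obtain H where "infinite H" "homogeneous c H" using homogeneous_exists by blast
  with c have "(p, indicator H) \<in> (RT2 k)" unfolding RT2_def by blast
  then show "p \<in> Domain (RT2 k)" ..
qed

lemma Domain_SRT2: "Domain (SRT2 k) = {coloring_name c | c. c \<in> [UNIV]\<^bsup>2\<^esup> \<rightarrow> {..<k} \<and> stable_coloring c}"
proof (intro set_eqI iffI)
  fix p assume "p \<in> Domain (SRT2 k)"
  then show "p \<in> {coloring_name c | c. c \<in> [UNIV]\<^bsup>2\<^esup> \<rightarrow> {..<k} \<and> stable_coloring c}"
    unfolding SRT2_def by (elim DomainE CollectE exE conjE Pair_inject) blast
next
  fix p assume "p \<in> {coloring_name c | c. c \<in> [UNIV]\<^bsup>2\<^esup> \<rightarrow> {..<k} \<and> stable_coloring c}"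
  then obtain c where c: "p = coloring_name c" "c \<in> [UNIV]\<^bsup>2\<^esup> \<rightarrow> {..<k} \<and> stable_coloring c" by blast
  then obtain H where "infinite H" "homogeneous c H" using homogeneous_exists by blast
  with c have "(p, indicator H) \<in> (SRT2 k)" unfolding SRT2_def by blast
  then show "p \<in> Domain (SRT2 k)" ..
qed

lemma Domain_SRT2_N: "Domain SRT2_N = {coloring_name c | c. (\<exists>k. c \<in> [UNIV]\<^bsup>2\<^esup> \<rightarrow> {..<k}) \<and> stable_coloring c}"
proof (intro set_eqI iffI)
  fix p assume "p \<in> Domain SRT2_N"
  then show "p \<in> {coloring_name c | c. (\<exists>k. c \<in> [UNIV]\<^bsup>2\<^esup> \<rightarrow> {..<k}) \<and> stable_coloring c}"
    unfolding SRT2_N_def by (elim DomainE CollectE exE conjE Pair_inject) blast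
next
  fix p assume "p \<in> {coloring_name c | c. (\<exists>k. c \<in> [UNIV]\<^bsup>2\<^esup> \<rightarrow> {..<k}) \<and> stable_coloring c}"
  then obtain c where c: "p = coloring_name c" "(\<exists>k. c \<in> [UNIV]\<^bsup>2\<^esup> \<rightarrow> {..<k}) \<and> stable_coloring c" by blast
  then obtain H where "infinite H" "homogeneous c H" using homogeneous_exists by blast
  with c have "(p, indicator H) \<in> SRT2_N" unfolding SRT2_N_def by blast
  then show "p \<in> Domain SRT2_N" ..
qed

lemma Domain_Ind_E:
  "Domain (Ind_E k) = {instance_name D R c | D R c. presentation_E D R \<and> c \<in> D \<rightarrow> {..<k}}"
proof (intro set_eqI iffI)
  fix p assume "p \<in> Domain (Ind_E k)"
  then show "p \<in> {instance_name D R c | D R c. presentation_E D R \<and> c \<in> D \<rightarrow> {..<k}}"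
    unfolding Ind_E_def by (elim DomainE CollectE exE conjE Pair_inject) blast
next
  fix p assume "p \<in> {instance_name D R c | D R c. presentation_E D R \<and> c \<in> D \<rightarrow> {..<k}}"
  then obtain D R c where p: "p = instance_name D R c" "presentation_E D R" "c \<in> D \<rightarrow> {..<k}" by blast
  from p(3) have "finite (c ` D)"
    by (intro finite_subset[OF _ finite_lessThan[of k]]) auto
  with p(2) obtain B where "mono_copy_E D R c B" using mono_copy_E_exists by blast
  with p have "(p, indicator B) \<in> (Ind_E k)" unfolding Ind_E_def by blast
  then show "p \<in> Domain (Ind_E k)" ..
qed

lemma Domain_Ind_E_N:
  "Domain Ind_E_N = {instance_name D R c | D R c. presentation_E D R \<and> finite (c ` D)}"
proof (intro set_eqI iffI)
  fix p assume "p \<in> Domain Ind_E_N"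
  then show "p \<in> {instance_name D R c | D R c. presentation_E D R \<and> finite (c ` D)}"
    unfolding Ind_E_N_def by (elim DomainE CollectE exE conjE Pair_inject) blast
next
  fix p assume "p \<in> {instance_name D R c | D R c. presentation_E D R \<and> finite (c ` D)}"
  then obtain D R c where p: "p = instance_name D R c" "presentation_E D R" "finite (c ` D)" by blast
  from p(3) have "finite (c ` D)" .
  with p(2) obtain B where "mono_copy_E D R c B" using mono_copy_E_exists by blast
  with p have "(p, indicator B) \<in> Ind_E_N" unfolding Ind_E_N_def by blast
  then show "p \<in> Domain Ind_E_N" ..
qed

end

theory Submission
  imports Defs "HOL-Library.Countable"
begin

text \<open>
  The coloring of pairs \<open>c\<close> becomes the coloring \<open>(x, m) \<mapsto> c {x, x + 1 + m}\<close> of the standard presentation.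
  If \<open>c\<close> is stable, the classes met by a monochromatic copy all have the same limit color, and a
  homogeneous set can be found among them greedily.  Conversely, choose for \<open>x < y\<close> an element
  of the \<open>x\<close>-th class beyond \<open>y\<close> and color \<open>{x, y}\<close> like this element; the elements chosen for the
  pairs of a homogeneous set form a monochromatic copy.

  Each instance of the indivisibility problem has a solution which is co-enumerable in it, whereas
  Jockusch's construction yields a coloring of pairs without homogeneous sets that are limits of
  approximations taken from a countable family.  Since the coloring itself need not be computable,
  the approximations may depend on its initial segments in any way, and no universal functional
  is needed.

  Suppose finally that the indivisibility problem reduced uniformly to stable colorings.  A finite
  homogeneous set commits the backward functional to put a point \<open>b\<close> into the copy, and \<open>b\<close> can be taken
  in a class of which only finitely much is fixed.  Giving the rest of this class the other color
  makes this a mistake, so the limit color of that finite set cannot be attained infinitely often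
  any more.  Doing this repeatedly leaves no limit color at all.
\<close>

section \<open>Closure properties of computable functions\<close>

text \<open>One program has to serve all oracles in \<open>S\<close>, which is the uniformity
  demanded by a Weihrauch reduction. Restricting the oracles to \<open>S\<close> makes room for
  unbounded searches that succeed only on names of genuine instances.\<close>

definition computable_on :: "(nat \<Rightarrow> nat) set \<Rightarrow> nat \<Rightarrow> ((nat \<Rightarrow> nat) \<Rightarrow> nat list \<Rightarrow> nat) \<Rightarrow> bool" where
  "computable_on S k F \<longleftrightarrow> (\<exists>e. \<forall>p\<in>S. \<forall>xs. length xs = k \<longrightarrow> eval p e xs (F p xs))"

definition decidable_on :: "(nat \<Rightarrow> nat) set \<Rightarrow> nat \<Rightarrow> ((nat \<Rightarrow> nat) \<Rightarrow> nat list \<Rightarrow> bool) \<Rightarrow> bool" where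
  "decidable_on S k P \<longleftrightarrow> computable_on S k (\<lambda>p xs. of_bool (P p xs))"

lemma computable_on_cong:
  assumes "computable_on S k F" and "\<And>p xs. p \<in> S \<Longrightarrow> length xs = k \<Longrightarrow> G p xs = F p xs"
  shows "computable_on S k G"
  using assms unfolding computable_on_def by auto

lemma computable_on_comp:
  assumes F: "computable_on S m F" and G: "\<And>i. i < m \<Longrightarrow> computable_on S k (G i)"
  shows "computable_on S k (\<lambda>p xs. F p (map (\<lambda>i. G i p xs) [0..<m]))"
proof -
  obtain e where e: "\<And>p xs. p \<in> S \<Longrightarrow> length xs = m \<Longrightarrow> eval p e xs (F p xs)"
    using F unfolding computable_on_def by blast
  have "\<forall>i. \<exists>g. i < m \<longrightarrow> (\<forall>p\<in>S. \<forall>xs. length xs = k \<longrightarrow> eval p g xs (G i p xs))"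
    using G unfolding computable_on_def by blast
  then obtain g where g: "\<And>i p xs. i < m \<Longrightarrow> p \<in> S \<Longrightarrow> length xs = k \<Longrightarrow> eval p (g i) xs (G i p xs)"
    by metis
  have "eval p (Comp e (map g [0..<m])) xs (F p (map (\<lambda>i. G i p xs) [0..<m]))"
    if "p \<in> S" "length xs = k" for p xs
    by (rule eval_Comp[where ys = "map (\<lambda>i. G i p xs) [0..<m]"])
      (use that in \<open>auto simp: list_all2_conv_all_nth intro: g e\<close>)
  then show ?thesis unfolding computable_on_def by blast
qed

lemma computable_on_comp1:
  assumes "computable_on S 1 (\<lambda>p xs. f p (xs ! 0))" and "computable_on S k A"
  shows "computable_on S k (\<lambda>p xs. f p (A p xs))"
  using computable_on_comp[OF assms(1), of k "\<lambda>i. A"] assms(2) by simp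

lemma computable_on_comp2:
  assumes "computable_on S 2 (\<lambda>p xs. f p (xs ! 0) (xs ! 1))"
    and "computable_on S k A" and "computable_on S k B"
  shows "computable_on S k (\<lambda>p xs. f p (A p xs) (B p xs))"
  using computable_on_comp[OF assms(1), of k "\<lambda>i. if i = 0 then A else B"] assms(2,3)
  by simp

lemma computable_on_nth: "i < k \<Longrightarrow> computable_on S k (\<lambda>p xs. xs ! i)"
  unfolding computable_on_def by (blast intro: eval_Proj)

lemma computable_on_tl_nth:
  "Suc i < k \<Longrightarrow> computable_on S k (\<lambda>p xs. tl xs ! i)"
  "Suc (Suc i) < k \<Longrightarrow> computable_on S k (\<lambda>p xs. tl (tl xs) ! i)"
  by (rule computable_on_cong[OF computable_on_nth]; simp add: nth_tl)+

lemma computable_on_Suc: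
  assumes "computable_on S k A" shows "computable_on S k (\<lambda>p xs. Suc (A p xs))"
proof (rule computable_on_comp1[OF _ assms])
  have "eval p Succ xs (Suc (xs ! 0))" if "length xs = 1" for p xs
    using that by (cases xs) (auto intro: eval_Succ)
  then show "computable_on S 1 (\<lambda>p xs. Suc (xs ! 0))" unfolding computable_on_def by blast
qed

lemma computable_on_oracle:
  assumes "computable_on S k A" shows "computable_on S k (\<lambda>p xs. p (A p xs))"
proof (rule computable_on_comp1[OF _ assms])
  have "eval p Oracle xs (p (xs ! 0))" if "length xs = 1" for p xs
    using that by (cases xs) (auto intro: eval_Oracle)
  then show "computable_on S 1 (\<lambda>p xs. p (xs ! 0))" unfolding computable_on_def by blast
qed

lemma computable_on_const: "computable_on S k (\<lambda>p xs. c)"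
proof (induction c)
  case 0
  show ?case unfolding computable_on_def by (blast intro: eval_Zero)
next
  case (Suc c)
  then show ?case by (rule computable_on_Suc)
qed

lemma computable_on_rec_nat:
  assumes N: "computable_on S k N" and A: "computable_on S k A"
    and G: "computable_on S (Suc (Suc k)) (\<lambda>p xs. G p (tl (tl xs)) (xs ! 0) (xs ! 1))"
  shows "computable_on S k (\<lambda>p xs. rec_nat (A p xs) (G p xs) (N p xs))"
proof -
  obtain a where a: "\<And>p xs. p \<in> S \<Longrightarrow> length xs = k \<Longrightarrow> eval p a xs (A p xs)"
    using A unfolding computable_on_def by blast
  obtain g where g: "\<And>p xs. p \<in> S \<Longrightarrow> length xs = Suc (Suc k) \<Longrightarrow>
      eval p g xs (G p (tl (tl xs)) (xs ! 0) (xs ! 1))"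
    using G unfolding computable_on_def by blast
  have "eval p (PrimRec a g) (n # xs) (rec_nat (A p xs) (G p xs) n)"
    if "p \<in> S" "length xs = k" for p xs n
  proof (induction n)
    case 0
    show ?case using a that by (auto intro: eval_PrimRec_0)
  next
    case (Suc n)
    show ?case using eval_PrimRec_Suc[OF Suc] g[of p "n # rec_nat (A p xs) (G p xs) n # xs"] that by simp
  qed
  then have "eval p (PrimRec a g) xs (rec_nat (A p (tl xs)) (G p (tl xs)) (xs ! 0))"
    if "p \<in> S" "length xs = Suc k" for p xs using that by (cases xs) auto
  then have R: "computable_on S (Suc k) (\<lambda>p xs. rec_nat (A p (tl xs)) (G p (tl xs)) (xs ! 0))"
    unfolding computable_on_def by blast
  have *: "computable_on S k (\<lambda>p xs. rec_nat (A p (map (\<lambda>i. xs ! i) [0..<k])) (G p (map (\<lambda>i. xs ! i) [0..<k])) (N p xs))"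
    using computable_on_comp[OF R, of k "\<lambda>i. if i = 0 then N else (\<lambda>p xs. xs ! (i - 1))"] N
    by (simp add: computable_on_nth upt_conv_Cons map_Suc_upt[symmetric] comp_def del: upt_Suc)
  have "map (\<lambda>i. xs ! i) [0..<k] = xs" if "length xs = k" for xs :: "nat list"
    using map_nth[of xs] that by simp
  then show ?thesis by (intro computable_on_cong[OF *]) simp
qed

lemma computable_on_Least:
  assumes P: "decidable_on S (Suc k) (\<lambda>p xs. P p (tl xs) (xs ! 0))"
    and ex: "\<And>p xs. p \<in> S \<Longrightarrow> length xs = k \<Longrightarrow> \<exists>n. P p xs n"
  shows "computable_on S k (\<lambda>p xs. LEAST n. P p xs n)"
proof -
  \<comment> \<open>\<open>Mu\<close> searches for a zero whereas truth is coded by 1, so the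
    characteristic function is first negated by a recursion with constant step 0.\<close>
  have "computable_on S (Suc k) (\<lambda>p xs. rec_nat 1 (\<lambda>_ _. 0) (of_bool (P p (tl xs) (xs ! 0))))"
    using P unfolding decidable_on_def by (intro computable_on_rec_nat computable_on_const)
  then obtain e where e: "\<And>p xs. p \<in> S \<Longrightarrow> length xs = Suc k \<Longrightarrow>
      eval p e xs (rec_nat 1 (\<lambda>_ _. 0) (of_bool (P p (tl xs) (xs ! 0))))"
    unfolding computable_on_def by blast
  have "eval p (Mu e) xs (LEAST n. P p xs n)" if S: "p \<in> S" "length xs = k" for p xs
  proof (rule eval_Mu)
    have "P p xs (LEAST n. P p xs n)" using ex[OF S] by (rule LeastI_ex)
    then show "eval p e ((LEAST n. P p xs n) # xs) 0"
      using e[of p "(LEAST n. P p xs n) # xs"] S by simp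
    show "\<forall>m<LEAST n. P p xs n. \<exists>y. eval p e (m # xs) (Suc y)"
    proof (intro allI impI)
      fix m assume "m < (LEAST n. P p xs n)"
      then have "\<not> P p xs m" by (rule not_less_Least)
      then show "\<exists>y. eval p e (m # xs) (Suc y)" using e[of p "m # xs"] S by auto
    qed
  qed
  then show ?thesis unfolding computable_on_def by blast
qed

lemma computable_on_add:
  assumes "computable_on S k A" "computable_on S k B"
  shows "computable_on S k (\<lambda>p xs. A p xs + B p xs)"
proof -
  have "rec_nat a (\<lambda>_. Suc) b = a + b" for a b by (induction b) auto
  then show ?thesis
    using computable_on_rec_nat[OF assms(2,1), of "\<lambda>_ _ _. Suc"]
    by (simp add: computable_on_Suc computable_on_nth)
qed

lemma computable_on_mult:
  assumes "computable_on S k A" "computable_on S k B"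
  shows "computable_on S k (\<lambda>p xs. A p xs * B p xs)"
proof (rule computable_on_comp2[OF _ assms])
  have "rec_nat 0 (\<lambda>_ y. y + a) b = a * b" for a b by (induction b) auto
  moreover have "computable_on S 2 (\<lambda>p xs. rec_nat 0 (\<lambda>_ y. y + xs ! 0) (xs ! 1))"
    by (intro computable_on_rec_nat computable_on_const computable_on_add computable_on_nth computable_on_tl_nth) auto
  ultimately show "computable_on S 2 (\<lambda>p xs. xs ! 0 * xs ! 1)" by simp
qed

lemma computable_on_diff:
  assumes "computable_on S k A" "computable_on S k B"
  shows "computable_on S k (\<lambda>p xs. A p xs - B p xs)"
proof (rule computable_on_comp2[OF _ assms])
  have pred: "computable_on S k (\<lambda>p xs. C p xs - 1)" if "computable_on S k C" for k C
  proof -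
    have "rec_nat 0 (\<lambda>n _. n) b = b - 1" for b by (induction b) auto
    moreover have "computable_on S k (\<lambda>p xs. rec_nat 0 (\<lambda>n _. n) (C p xs))"
      by (intro computable_on_rec_nat computable_on_const computable_on_nth that) auto
    ultimately show ?thesis by simp
  qed
  have "rec_nat a (\<lambda>_ y. y - 1) b = a - b" for a b by (induction b) auto
  moreover have "computable_on S 2 (\<lambda>p xs. rec_nat (xs ! 0) (\<lambda>_ y. y - 1) (xs ! 1))"
    by (intro computable_on_rec_nat pred computable_on_nth) auto
  ultimately show "computable_on S 2 (\<lambda>p xs. xs ! 0 - xs ! 1)" by simp
qed

section \<open>Decidable predicates\<close>

lemma decidable_on_eq0:
  assumes "computable_on S k A" shows "decidable_on S k (\<lambda>p xs. A p xs = 0)"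
proof -
  have "of_bool (a = 0) = 1 - a" for a :: nat by (cases a) auto
  then show ?thesis unfolding decidable_on_def
    using computable_on_diff[OF computable_on_const assms] by simp
qed

lemma decidable_on_not:
  assumes "decidable_on S k P" shows "decidable_on S k (\<lambda>p xs. \<not> P p xs)"
  using decidable_on_eq0[of S k "\<lambda>p xs. of_bool (P p xs)"] assms unfolding decidable_on_def by simp

lemma decidable_on_conj:
  assumes "decidable_on S k P" "decidable_on S k Q"
  shows "decidable_on S k (\<lambda>p xs. P p xs \<and> Q p xs)"
  using computable_on_mult[OF assms[unfolded decidable_on_def]]
  unfolding decidable_on_def by (simp only: of_bool_conj)

lemma decidable_on_disj:
  assumes "decidable_on S k P" "decidable_on S k Q"
  shows "decidable_on S k (\<lambda>p xs. P p xs \<or> Q p xs)"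
  using decidable_on_not[OF decidable_on_conj[OF decidable_on_not[OF assms(1)] decidable_on_not[OF assms(2)]]]
  by simp

lemma decidable_on_imp:
  assumes "decidable_on S k P" "decidable_on S k Q"
  shows "decidable_on S k (\<lambda>p xs. P p xs \<longrightarrow> Q p xs)"
  using decidable_on_disj[OF decidable_on_not[OF assms(1)] assms(2)] by simp

lemma decidable_on_le:
  assumes "computable_on S k A" "computable_on S k B"
  shows "decidable_on S k (\<lambda>p xs. A p xs \<le> B p xs)"
  using decidable_on_eq0[OF computable_on_diff[OF assms]] by simp

lemma decidable_on_less:
  assumes "computable_on S k A" "computable_on S k B"
  shows "decidable_on S k (\<lambda>p xs. A p xs < B p xs)"
  using decidable_on_not[OF decidable_on_le[OF assms(2,1)]] by (simp add: not_le)

lemma decidable_on_eq: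
  assumes "computable_on S k A" "computable_on S k B"
  shows "decidable_on S k (\<lambda>p xs. A p xs = B p xs)"
  using decidable_on_conj[OF decidable_on_le[OF assms] decidable_on_le[OF assms(2,1)]]
  by (simp add: eq_iff)

lemma computable_on_if:
  assumes "decidable_on S k P" "computable_on S k A" "computable_on S k B"
  shows "computable_on S k (\<lambda>p xs. if P p xs then A p xs else B p xs)"
proof -
  have "computable_on S k (\<lambda>p xs. of_bool (P p xs) * A p xs + of_bool (\<not> P p xs) * B p xs)"
    using assms decidable_on_not[OF assms(1)] unfolding decidable_on_def
    by (intro computable_on_add computable_on_mult)
  then show ?thesis by (rule computable_on_cong) auto
qed

text \<open>The search for a number that is a witness or exceeds the bound always terminates, and it
  stops within the bound iff there is a witness. \<open>B'\<close> is the computability of the bound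
  once the search variable has been put in front of the arguments.\<close>

lemma decidable_on_ex_le:
  assumes B: "computable_on S k B" and P: "decidable_on S (Suc k) (\<lambda>p xs. P p (tl xs) (xs ! 0))"
    and B': "computable_on S (Suc k) (\<lambda>p xs. B p (tl xs))"
  shows "decidable_on S k (\<lambda>p xs. \<exists>i\<le>B p xs. P p xs i)"
proof -
  have "computable_on S k (\<lambda>p xs. LEAST i. B p xs < i \<or> P p xs i)"
    by (rule computable_on_Least)
      (auto intro!: decidable_on_disj decidable_on_less B' P computable_on_nth)
  then have "decidable_on S k (\<lambda>p xs. (LEAST i. B p xs < i \<or> P p xs i) \<le> B p xs)"
    by (intro decidable_on_le B)
  moreover have "(LEAST i. b < i \<or> Q i) \<le> b \<longleftrightarrow> (\<exists>i\<le>b. Q i)" for b :: nat and Q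
  proof
    have "b < (LEAST i. b < i \<or> Q i) \<or> Q (LEAST i. b < i \<or> Q i)"
      by (rule LeastI_ex) blast
    then show "\<exists>i\<le>b. Q i" if "(LEAST i. b < i \<or> Q i) \<le> b" using that by auto
    show "(LEAST i. b < i \<or> Q i) \<le> b" if "\<exists>i\<le>b. Q i"
      using that Least_le[of "\<lambda>i. b < i \<or> Q i"] le_trans by blast
  qed
  ultimately show ?thesis by simp
qed

lemma decidable_on_all_le:
  assumes "computable_on S k B" and "decidable_on S (Suc k) (\<lambda>p xs. P p (tl xs) (xs ! 0))"
    and "computable_on S (Suc k) (\<lambda>p xs. B p (tl xs))"
  shows "decidable_on S k (\<lambda>p xs. \<forall>i\<le>B p xs. P p xs i)"
  using decidable_on_not[OF decidable_on_ex_le[OF assms(1) decidable_on_not[OF assms(2)] assms(3)]]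
  by simp

lemma computable_on_of_bool: "decidable_on S k P \<Longrightarrow> computable_on S k (\<lambda>p xs. of_bool (P p xs))"
  unfolding decidable_on_def .

lemmas computable_intros =
  computable_on_nth computable_on_tl_nth computable_on_const computable_on_Suc computable_on_add
  computable_on_mult computable_on_diff computable_on_if computable_on_of_bool
  decidable_on_not decidable_on_conj decidable_on_disj decidable_on_imp
  decidable_on_le decidable_on_less decidable_on_eq decidable_on_ex_le decidable_on_all_le

section \<open>Halving and Cantor pairing\<close>

lemma computable_on_div2:
  assumes "computable_on S k A" shows "computable_on S k (\<lambda>p xs. A p xs div 2)"
proof (rule computable_on_comp1[OF _ assms])
  have "computable_on S 1 (\<lambda>p xs. LEAST i. xs ! 0 < 2 * i + 2)"
  proof (rule computable_on_Least)
    show "\<exists>n. xs ! 0 < 2 * n + 2" for xs :: "nat list" by (rule exI[of _ "xs ! 0"]) simp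
  qed (intro computable_intros; simp)
  moreover have "(LEAST i. n < 2 * i + 2) = n div 2" for n :: nat
    by (rule Least_equality) auto
  ultimately show "computable_on S 1 (\<lambda>p xs. xs ! 0 div 2)" by simp
qed

lemma decidable_on_even:
  assumes "computable_on S k A" shows "decidable_on S k (\<lambda>p xs. even (A p xs))"
proof -
  have "even n \<longleftrightarrow> 2 * (n div 2) = n" for n :: nat by presburger
  moreover have "decidable_on S k (\<lambda>p xs. 2 * (A p xs div 2) = A p xs)"
    by (intro computable_intros computable_on_div2 assms)
  ultimately show ?thesis by (simp only:)
qed

lemma computable_on_prod_encode:
  assumes "computable_on S k A" "computable_on S k B"
  shows "computable_on S k (\<lambda>p xs. prod_encode (A p xs, B p xs))"
proof -
  have "computable_on S k (\<lambda>p xs. ((A p xs + B p xs) * Suc (A p xs + B p xs)) div 2 + A p xs)"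
    by (intro computable_intros computable_on_div2 assms)
  then show ?thesis by (simp add: prod_encode_def triangle_def)
qed

lemma Least_eq: "(LEAST i. i = a) = (a :: 'a :: order)"
  by (rule Least_equality) auto

text \<open>Both components of a pair are at most its code, so the first one is found by a search
  whose test has only a bounded quantifier.\<close>

lemma computable_on_fst_prod_decode:
  assumes "computable_on S k A" shows "computable_on S k (\<lambda>p xs. fst (prod_decode (A p xs)))"
proof (rule computable_on_comp1[OF _ assms])
  have eq: "(\<exists>j\<le>n. prod_encode (i, j) = n) \<longleftrightarrow> i = fst (prod_decode n)" for i n
  proof
    show "\<exists>j\<le>n. prod_encode (i, j) = n" if "i = fst (prod_decode n)"
      using that le_prod_encode_2[of "snd (prod_decode n)" i]
      by (intro exI[of _ "snd (prod_decode n)"]) simp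
  qed auto
  have "computable_on S 1 (\<lambda>p xs. LEAST i. \<exists>j\<le>xs ! 0. prod_encode (i, j) = xs ! 0)"
  proof (rule computable_on_Least)
    show "\<exists>i. \<exists>j\<le>xs ! 0. prod_encode (i, j) = xs ! 0" for xs :: "nat list" unfolding eq by blast
  qed (intro computable_intros computable_on_prod_encode; simp)
  then show "computable_on S 1 (\<lambda>p xs. fst (prod_decode (xs ! 0)))"
    unfolding eq by (simp add: Least_eq)
qed

lemma computable_on_snd_prod_decode:
  assumes "computable_on S k A" shows "computable_on S k (\<lambda>p xs. snd (prod_decode (A p xs)))"
proof (rule computable_on_comp1[OF _ assms])
  have eq: "(\<exists>j\<le>n. prod_encode (j, i) = n) \<longleftrightarrow> i = snd (prod_decode n)" for i n
  proof
    show "\<exists>j\<le>n. prod_encode (j, i) = n" if "i = snd (prod_decode n)"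
      using that le_prod_encode_1[of "fst (prod_decode n)" i]
      by (intro exI[of _ "fst (prod_decode n)"]) simp
  qed auto
  have "computable_on S 1 (\<lambda>p xs. LEAST i. \<exists>j\<le>xs ! 0. prod_encode (j, i) = xs ! 0)"
  proof (rule computable_on_Least)
    show "\<exists>i. \<exists>j\<le>xs ! 0. prod_encode (j, i) = xs ! 0" for xs :: "nat list" unfolding eq by blast
  qed (intro computable_intros computable_on_prod_encode; simp)
  then show "computable_on S 1 (\<lambda>p xs. snd (prod_decode (xs ! 0)))"
    unfolding eq by (simp add: Least_eq)
qed

lemma computable_on_functional:
  assumes "computable_on S 1 (\<lambda>p xs. f p (xs ! 0))"
  obtains e where "\<And>p. p \<in> S \<Longrightarrow> functional e p (f p)"
proof -
  from assms obtain e where e: "\<And>p xs. p \<in> S \<Longrightarrow> length xs = 1 \<Longrightarrow> eval p e xs (f p (xs ! 0))"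
    unfolding computable_on_def by blast
  have "functional e p (f p)" if "p \<in> S" for p
    unfolding functional_def using e[OF that, of "[_]"] by simp
  then show ?thesis by (rule that)
qed

section \<open>Finite use\<close>

text \<open>A halting computation consults its oracle finitely often. Composition and minimization
  involve finitely many subcomputations, so their uses have a common bound.\<close>

lemma eval_use: "eval p e xs y \<Longrightarrow> \<exists>u. \<forall>q. (\<forall>n<u. q n = p n) \<longrightarrow> eval q e xs y"
proof (induction rule: eval.induct)
  case (eval_Oracle x)
  show ?case by (rule exI[of _ "Suc x"]) (metis eval.eval_Oracle lessI)
next
  case (eval_Comp xs gs ys f z)
  from eval_Comp.IH(2) obtain u where u: "\<And>q. (\<forall>n<u. q n = p n) \<Longrightarrow> eval q f ys z" by blast
  have len: "length gs = length ys" using eval_Comp.IH(1) by (rule list_all2_lengthD)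
  have "\<forall>i. \<exists>v. i < length gs \<longrightarrow> (\<forall>q. (\<forall>n<v. q n = p n) \<longrightarrow> eval q (gs ! i) xs (ys ! i))"
    using list_all2_nthD[OF eval_Comp.IH(1)] by blast
  then obtain v where v: "\<And>i q. i < length gs \<Longrightarrow> (\<forall>n<v i. q n = p n) \<Longrightarrow> eval q (gs ! i) xs (ys ! i)"
    by metis
  obtain w where w: "\<forall>i<length gs. v i < w"
    using finite_nat_set_iff_bounded[of "v ` {..<length gs}"] by auto
  show ?case
  proof (intro exI[of _ "max u w"] allI impI)
    fix q assume q: "\<forall>n<max u w. q n = p n"
    have "list_all2 (\<lambda>g y. eval q g xs y) gs ys"
      unfolding list_all2_conv_all_nth using len w q by (auto intro!: v)
    moreover have "eval q f ys z" using q by (auto intro!: u)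
    ultimately show "eval q (Comp f gs) xs z" by (rule eval.eval_Comp)
  qed
next
  case (eval_PrimRec_Suc f g n xs y z)
  from eval_PrimRec_Suc.IH obtain u v where
    "\<forall>q. (\<forall>n<u. q n = p n) \<longrightarrow> eval q (PrimRec f g) (n # xs) y"
    "\<forall>q. (\<forall>n<v. q n = p n) \<longrightarrow> eval q g (n # y # xs) z" by blast
  then have "\<forall>q. (\<forall>n<max u v. q n = p n) \<longrightarrow> eval q (PrimRec f g) (Suc n # xs) z"
    by (metis eval.eval_PrimRec_Suc max_less_iff_conj less_max_iff_disj)
  then show ?case ..
next
  case (eval_Mu f n xs)
  from eval_Mu.IH(1) obtain u where u: "\<And>q. (\<forall>n<u. q n = p n) \<Longrightarrow> eval q f (n # xs) 0" by blast
  from eval_Mu.IH(2) obtain v where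
    v: "\<And>m q. m < n \<Longrightarrow> (\<forall>n<v m. q n = p n) \<Longrightarrow> \<exists>y. eval q f (m # xs) (Suc y)" by metis
  obtain w where w: "\<forall>i<n. v i < w"
    using finite_nat_set_iff_bounded[of "v ` {..<n}"] by auto
  show ?case
  proof (intro exI[of _ "max u w"] allI impI)
    fix q assume q: "\<forall>n<max u w. q n = p n"
    show "eval q (Mu f) xs n"
    proof (rule eval.eval_Mu)
      show "eval q f (n # xs) 0" using q by (auto intro!: u)
      show "\<forall>m<n. \<exists>y. eval q f (m # xs) (Suc y)" using q w by (auto intro!: v)
    qed
  qed
next
  case (eval_PrimRec_0 f xs y g)
  then show ?case using eval.eval_PrimRec_0 by blast
qed (auto intro: eval.intros)

text \<open>Position \<open>m\<close> of a join is read from position \<open>m div 2 \<le> m\<close>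
  of one of its halves, so the same bound \<open>u\<close> works on both sides.\<close>

lemma join_agree:
  assumes "\<forall>m<u. p m = p' m" "\<forall>m<u. q m = q' m"
  shows "\<forall>m<u. (p \<oplus>\<^sub>J q) m = (p' \<oplus>\<^sub>J q') m"
  using assms by (auto simp: join_def intro: le_less_trans[OF div_le_dividend])

section \<open>Presentations and their copies\<close>

text \<open>That there are infinitely many classes is expressed by the last clause: no finite set
  meets all of them. This form avoids quotients and is the one in which new classes are requested
  later.\<close>

definition E_like :: "'a set \<Rightarrow> ('a \<times> 'a) set \<Rightarrow> bool" where
  "E_like B S \<longleftrightarrow> equiv B S \<and> (\<forall>x\<in>B. infinite (S `` {x})) \<and>
     (\<forall>F. finite F \<longrightarrow> (\<exists>x\<in>B. \<forall>y\<in>F. (y, x) \<notin> S))"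

lemma isomorphic_imp_E_like:
  assumes S: "S \<subseteq> B \<times> B" and iso: "isomorphic B S UNIV E_rel"
  shows "E_like B S"
proof -
  from iso obtain f where f: "bij_betw f B UNIV"
    and fS: "\<forall>x\<in>B. \<forall>y\<in>B. (x, y) \<in> S \<longleftrightarrow> (f x, f y) \<in> E_rel"
    unfolding isomorphic_def by blast
  have E: "(a, b) \<in> E_rel \<longleftrightarrow> fst a = fst b" for a b
    unfolding E_rel_def by (cases a; cases b) auto
  have S_iff: "(x, y) \<in> S \<longleftrightarrow> x \<in> B \<and> y \<in> B \<and> fst (f x) = fst (f y)" for x y
    using S fS E by blast
  define g where "g = inv_into B f"
  have g: "g z \<in> B" "f (g z) = z" for z
    using f unfolding g_def bij_betw_def by (auto intro: inv_into_into f_inv_into_f)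
  have "equiv B S"
    using S by (intro equivI refl_onI symI transI) (auto simp: S_iff)
  moreover have "infinite (S `` {x})" if "x \<in> B" for x
  proof
    assume "finite (S `` {x})"
    moreover have "(\<lambda>n. g (fst (f x), n)) ` UNIV \<subseteq> S `` {x}" using that g by (auto simp: S_iff)
    moreover have "inj (\<lambda>n. g (fst (f x), n))" by (rule injI, drule arg_cong[of _ _ f]) (simp add: g)
    ultimately show False by (meson finite_imageD finite_subset infinite_UNIV_nat)
  qed
  moreover have "\<exists>x\<in>B. \<forall>y\<in>F. (y, x) \<notin> S" if F: "finite F" for F
  proof -
    obtain n where n: "n \<notin> (fst \<circ> f) ` F"
      using ex_new_if_finite[OF infinite_UNIV_nat finite_imageI[OF F]] by blast
    have "(y, g (n, 0)) \<notin> S" if "y \<in> F" for y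
      using n that unfolding S_iff g(2) by force
    then show ?thesis using g(1) by blast
  qed
  ultimately show ?thesis unfolding E_like_def by blast
qed

text \<open>Number the classes, and the elements within each class; the two numbers of an element
  are its coordinates in the standard copy.\<close>

lemma E_like_imp_isomorphic:
  fixes B :: "nat set"
  assumes "E_like B S"
  shows "isomorphic B S UNIV E_rel"
proof -
  from assms have eq: "equiv B S" and inf: "\<And>x. x \<in> B \<Longrightarrow> infinite (S `` {x})"
    and new: "\<And>F. finite F \<Longrightarrow> \<exists>x\<in>B. \<forall>y\<in>F. (y, x) \<notin> S" unfolding E_like_def by blast+
  define r where "r C = to_nat_on (B // S) C" for C
  define t where "t C = to_nat_on C" for C :: "nat set"
  have cnt: "countable (B // S)" unfolding quotient_def by simp
  have "infinite (B // S)"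
  proof
    assume fin: "finite (B // S)"
    \<comment> \<open>If there were only finitely many classes, one representative from each would
      form a finite set meeting all of them.\<close>
    define F where "F = (\<lambda>C. SOME y. y \<in> C) ` (B // S)"
    have "finite F" using fin unfolding F_def by simp
    then obtain x where x: "x \<in> B" "\<forall>y\<in>F. (y, x) \<notin> S" using new by blast
    have "S `` {x} \<in> B // S" using x(1) by (rule quotientI)
    moreover have "(SOME y. y \<in> S `` {x}) \<in> S `` {x}"
      by (rule someI_ex) (use x(1) eq in \<open>auto simp: equiv_def refl_on_def\<close>)
    moreover have "sym S" using eq by (simp add: equiv_def)
    ultimately show False using x(2) unfolding F_def by (metis Image_singleton_iff imageI symD)
  qed
  then have r: "bij_betw r (B // S) UNIV"
    using to_nat_on_infinite[OF cnt] unfolding r_def by simp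
  have t: "bij_betw (t C) C UNIV" if "C \<in> B // S" for C
    using that inf unfolding t_def by (intro to_nat_on_infinite) (auto elim!: quotientE)
  define h where "h x = (r (S `` {x}), t (S `` {x}) x)" for x
  have SS: "S `` {x} = S `` {y} \<longleftrightarrow> (x, y) \<in> S" if "x \<in> B" "y \<in> B" for x y
    using eq_equiv_class_iff[OF eq that] .
  have r_eq: "r (S `` {x}) = r (S `` {y}) \<longleftrightarrow> (x, y) \<in> S" if "x \<in> B" "y \<in> B" for x y
    using inj_on_eq_iff[of r "B // S"] SS[OF that] r that by (simp add: bij_betw_def quotientI)
  have self: "x \<in> S `` {x}" if "x \<in> B" for x
    using that eq by (auto simp: equiv_def refl_on_def)
  have "inj_on h B"
  proof (rule inj_onI)
    fix x y assume x: "x \<in> B" and y: "y \<in> B" and h: "h x = h y"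
    then have xy: "(x, y) \<in> S" using r_eq unfolding h_def by simp
    then have "S `` {x} = S `` {y}" using SS x y by blast
    then have "t (S `` {x}) x = t (S `` {x}) y" "y \<in> S `` {x}" using h xy unfolding h_def by auto
    moreover have "inj_on (t (S `` {x})) (S `` {x})"
      using t[OF quotientI[OF x]] by (simp add: bij_betw_def)
    ultimately show "x = y" using self[OF x] by (blast dest: inj_onD)
  qed
  moreover have "h ` B = UNIV"
  proof -
    have "(a, b) \<in> h ` B" for a b
    proof -
      obtain C where C: "C \<in> B // S" "r C = a" using r unfolding bij_betw_def by (metis UNIV_I imageE)
      obtain x where x: "x \<in> C" "t C x = b"
        using t[OF C(1)] unfolding bij_betw_def by (metis UNIV_I imageE)
      have "x \<in> B" using C(1) x(1) eq in_quotient_imp_subset by blast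
      moreover have "S `` {x} = C"
        using C(1) x(1) quotient_eqI[OF eq quotientI[OF \<open>x \<in> B\<close>] C(1) self[OF \<open>x \<in> B\<close>] x(1)] self[OF \<open>x \<in> B\<close>] eq
        by (auto simp: equiv_def refl_on_def)
      ultimately show ?thesis using C x unfolding h_def by force
    qed
    then show ?thesis by auto
  qed
  ultimately have "bij_betw h B UNIV" by (simp add: bij_betw_def)
  moreover have "(x, y) \<in> S \<longleftrightarrow> (h x, h y) \<in> E_rel" if "x \<in> B" "y \<in> B" for x y
    using r_eq[OF that] unfolding h_def E_rel_def by auto
  ultimately show ?thesis unfolding isomorphic_def by blast
qed

lemma presentation_E_iff: "presentation_E D R \<longleftrightarrow> R \<subseteq> D \<times> D \<and> E_like D R"
  unfolding presentation_E_def using isomorphic_imp_E_like E_like_imp_isomorphic by blast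

text \<open>A subset inherits the equivalence relation, so only the infinitude conditions remain to
  be checked. The last of them uses \<open>R\<close> instead of its restriction, so that classes of
  points outside \<open>B\<close> can be avoided as well.\<close>

lemma mono_copy_E_iff:
  assumes "presentation_E D R"
  shows "mono_copy_E D R c B \<longleftrightarrow> B \<subseteq> D \<and> (\<exists>i. \<forall>x\<in>B. c x = i) \<and>
    (\<forall>x\<in>B. infinite {y \<in> B. (x, y) \<in> R}) \<and> (\<forall>F. finite F \<longrightarrow> (\<exists>x\<in>B. \<forall>y\<in>F. (y, x) \<notin> R))"
proof -
  from assms have R: "R \<subseteq> D \<times> D" "equiv D R" by (simp_all only: presentation_E_iff E_like_def)
  have *: "isomorphic B (R \<inter> B \<times> B) UNIV E_rel \<longleftrightarrow>
      (\<forall>x\<in>B. infinite {y \<in> B. (x, y) \<in> R}) \<and> (\<forall>F. finite F \<longrightarrow> (\<exists>x\<in>B. \<forall>y\<in>F. (y, x) \<notin> R))"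
    (is "?iso \<longleftrightarrow> ?inf \<and> ?new") if B: "B \<subseteq> D"
  proof -
    have eq: "equiv B (R \<inter> B \<times> B)"
    proof (intro equivI refl_onI symI transI)
      fix x y z assume "(x, y) \<in> R \<inter> B \<times> B" "(y, z) \<in> R \<inter> B \<times> B"
      then show "(x, z) \<in> R \<inter> B \<times> B" using R(2) by (auto simp: equiv_def dest: transD)
    qed (use R(2) B in \<open>auto simp: equiv_def refl_on_def dest: symD\<close>)
    have im: "(R \<inter> B \<times> B) `` {x} = {y \<in> B. (x, y) \<in> R}" if "x \<in> B" for x using that by auto
    have new: ?new if avoid: "\<forall>F. finite F \<longrightarrow> (\<exists>x\<in>B. \<forall>y\<in>F. (y, x) \<notin> R \<inter> B \<times> B)"
    proof (intro allI impI)
      fix F :: "nat set" assume "finite F"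
      \<comment> \<open>Each \<open>y\<close> is replaced by a member of \<open>B\<close> from its
        class; where there is none, \<open>y\<close> is not related to any point of \<open>B\<close>
        anyway.\<close>
      then have "finite ((\<lambda>y. SOME b. b \<in> B \<and> (y, b) \<in> R) ` F)" by simp
      then obtain x where x: "x \<in> B"
        "\<And>y. y \<in> F \<Longrightarrow> (SOME b. b \<in> B \<and> (y, b) \<in> R, x) \<notin> R \<inter> B \<times> B"
        using avoid[THEN spec, of "(\<lambda>y. SOME b. b \<in> B \<and> (y, b) \<in> R) ` F"] by blast
      have "(y, x) \<notin> R" if y: "y \<in> F" for y
      proof
        assume yx: "(y, x) \<in> R"
        define b where "b = (SOME b. b \<in> B \<and> (y, b) \<in> R)"
        have "b \<in> B \<and> (y, b) \<in> R" unfolding b_def by (rule someI[of _ x]) (use yx x(1) in blast)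
        then have "(b, x) \<in> R \<inter> B \<times> B"
          using yx R(2) x(1) unfolding equiv_def by (meson IntI SigmaI symD transD)
        then show False using x(2)[OF y] unfolding b_def by blast
      qed
      then show "\<exists>x\<in>B. \<forall>y\<in>F. (y, x) \<notin> R" using x(1) by blast
    qed
    have "?iso \<longleftrightarrow> E_like B (R \<inter> B \<times> B)"
      using isomorphic_imp_E_like[of "R \<inter> B \<times> B" B] E_like_imp_isomorphic[of B "R \<inter> B \<times> B"]
      by (meson Int_lower2)
    also have "\<dots> \<longleftrightarrow> ?inf \<and> (\<forall>F. finite F \<longrightarrow> (\<exists>x\<in>B. \<forall>y\<in>F. (y, x) \<notin> R \<inter> B \<times> B))"
      unfolding E_like_def using eq im by simp
    also have "\<dots> \<longleftrightarrow> ?inf \<and> ?new"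
    proof (intro conj_cong refl iffI new)
      assume ?new
      then show "\<forall>F. finite F \<longrightarrow> (\<exists>x\<in>B. \<forall>y\<in>F. (y, x) \<notin> R \<inter> B \<times> B)" by (meson IntD1)
    qed
    finally show ?thesis .
  qed
  show ?thesis unfolding mono_copy_E_def using * by (cases "B \<subseteq> D") simp_all
qed

definition standard_rel :: "(nat \<times> nat) set" where
  "standard_rel = {(a, b). fst (prod_decode a) = fst (prod_decode b)}"

lemma presentation_standard: "presentation_E UNIV standard_rel"
proof -
  have "(x, y) \<in> standard_rel \<longleftrightarrow> (prod_decode x, prod_decode y) \<in> E_rel" for x y
    unfolding standard_rel_def E_rel_def by (cases "prod_decode x"; cases "prod_decode y") auto
  then show ?thesis
    unfolding presentation_E_def isomorphic_def using bij_prod_decode by auto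
qed

lemma join_inject: "p \<oplus>\<^sub>J q = p' \<oplus>\<^sub>J q' \<longleftrightarrow> p = p' \<and> q = q'"
proof
  assume eq: "p \<oplus>\<^sub>J q = p' \<oplus>\<^sub>J q'"
  have "p n = p' n" "q n = q' n" for n
    using fun_cong[OF eq, of "2 * n"] fun_cong[OF eq, of "2 * n + 1"] by (simp_all add: join_def)
  then show "p = p' \<and> q = q'" by blast
qed simp

lemma indicator_nat_inject: "(indicator A :: 'a \<Rightarrow> nat) = indicator B \<longleftrightarrow> A = B"
  by (metis indicator_eq_1_iff subsetI subset_antisym)

lemma instance_name_inject:
  "instance_name D R c = instance_name D' R' c' \<longleftrightarrow> D = D' \<and> R = R' \<and> c = c'"
  unfolding instance_name_def join_inject indicator_nat_inject
  by (simp add: inj_image_eq_iff[OF inj_prod_encode] conj_assoc)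

lemma instance_name_nth:
  "instance_name D R c (4 * d) = indicator D d"
  "instance_name D R c (4 * m + 2) = indicator (prod_encode ` R) m"
  "instance_name D R c (2 * d + 1) = c d"
  by (auto simp: instance_name_def join_def)

section \<open>Colorings of pairs\<close>

text \<open>Reads the color of \<open>{a, b}\<close> off a name when \<open>a < b\<close>, undoing
  the coding in \<open>coloring_name\<close>. For \<open>b \<le> a\<close> the truncated difference
  is 0 and the value is junk.\<close>

definition pair_color :: "(nat \<Rightarrow> nat) \<Rightarrow> nat \<Rightarrow> nat \<Rightarrow> nat" where
  "pair_color x a b = x (prod_encode (a, b - Suc a))"

definition limit_color :: "(nat \<Rightarrow> nat) \<Rightarrow> nat \<Rightarrow> nat \<Rightarrow> bool" where
  "limit_color x a j \<longleftrightarrow> (\<exists>N. \<forall>b\<ge>N. pair_color x a b = j)"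

definition mono_pairs :: "(nat \<Rightarrow> nat) \<Rightarrow> nat \<Rightarrow> nat set \<Rightarrow> bool" where
  "mono_pairs x j H \<longleftrightarrow> (\<forall>a\<in>H. \<forall>b\<in>H. a < b \<longrightarrow> pair_color x a b = j)"

lemma pair_color_coloring_name: "a < b \<Longrightarrow> pair_color (coloring_name c) a b = c {a, b}"
  by (simp add: pair_color_def coloring_name_def)

lemma homogeneous_iff_mono_pairs:
  "homogeneous c H \<longleftrightarrow> (\<exists>j. mono_pairs (coloring_name c) j H)"
proof -
  have "(\<forall>e\<in>[H]\<^bsup>2\<^esup>. c e = j) \<longleftrightarrow> mono_pairs (coloring_name c) j H" for j
  proof
    assume hom: "\<forall>e\<in>[H]\<^bsup>2\<^esup>. c e = j"
    have "c {a, b} = j" if "a \<in> H" "b \<in> H" "a < b" for a b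
      using hom that by (auto simp: nsets_def)
    then show "mono_pairs (coloring_name c) j H"
      unfolding mono_pairs_def by (auto simp: pair_color_coloring_name)
  next
    assume hom: "mono_pairs (coloring_name c) j H"
    have "c e = j" if e: "e \<in> [H]\<^bsup>2\<^esup>" for e
    proof -
      obtain a b where ab: "e = {a, b}" "a \<noteq> b" "e \<subseteq> H"
        using e unfolding nsets_def by (auto simp: card_2_iff)
      show ?thesis
      proof (cases "a < b")
        case True
        then show ?thesis using hom ab pair_color_coloring_name[OF True, of c]
          unfolding mono_pairs_def by auto
      next
        case False
        then have "b < a" using ab by simp
        then show ?thesis using hom ab pair_color_coloring_name[OF \<open>b < a\<close>, of c]
          unfolding mono_pairs_def by (auto simp: insert_commute)
      qed
    qed
    then show "\<forall>e\<in>[H]\<^bsup>2\<^esup>. c e = j" ..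
  qed
  then show ?thesis unfolding homogeneous_def by simp
qed

lemma stable_coloring_limit:
  assumes "stable_coloring c" shows "\<exists>j. limit_color (coloring_name c) n j"
proof -
  obtain j where "(\<lambda>m. c {n, m}) \<longlonglongrightarrow> j"
    using assms unfolding stable_coloring_def convergent_def by blast
  then obtain N where N: "\<forall>m\<ge>N. c {n, m} = j"
    unfolding tendsto_discrete eventually_sequentially by blast
  then have "\<forall>b\<ge>max N (Suc n). pair_color (coloring_name c) n b = j"
    by (simp add: pair_color_coloring_name)
  then show ?thesis unfolding limit_color_def by blast
qed

lemma limit_color_unique: "limit_color x n j \<Longrightarrow> limit_color x n j' \<Longrightarrow> j = j'"
  unfolding limit_color_def by (metis linear)

lemma coloring_name_bound:
  assumes "c \<in> [UNIV]\<^bsup>2\<^esup> \<rightarrow> {..<k}" shows "coloring_name c n < k"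
proof (cases "prod_decode n")
  case (Pair i j)
  have "{i, Suc (i + j)} \<in> [UNIV]\<^bsup>2\<^esup>" by (auto simp: nsets_def)
  then show ?thesis using assms Pair unfolding coloring_name_def by auto
qed

section \<open>The positive reductions\<close>

text \<open>The pair \<open>{x, x + 1 + m}\<close> has the same code as the point
  \<open>(x, m)\<close> of the presentation, so a name \<open>p\<close> of a pair coloring serves
  unchanged as a coloring of points. The explicit form lets the closure rules read off
  computability.\<close>

lemma instance_name_standard:
  "instance_name UNIV standard_rel p n =
    (if even n then
       (if even (n div 2) \<or> fst (prod_decode (fst (prod_decode (n div 2 div 2)))) =
          fst (prod_decode (snd (prod_decode (n div 2 div 2)))) then 1 else 0)
     else p (n div 2))"
proof -
  have "m \<in> prod_encode ` standard_rel \<longleftrightarrow>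
      fst (prod_decode (fst (prod_decode m))) = fst (prod_decode (snd (prod_decode m)))" for m
  proof -
    have "m \<in> prod_encode ` standard_rel \<longleftrightarrow> prod_decode m \<in> standard_rel"
      by (metis (no_types) imageE image_eqI prod_decode_inverse prod_encode_inverse)
    then show ?thesis unfolding standard_rel_def by (cases "prod_decode m") simp
  qed
  then show ?thesis by (simp add: instance_name_def join_def indicator_def)
qed

section \<open>Greedy homogeneous sets among the columns\<close>

definition column :: "nat \<Rightarrow> nat" where
  "column b = fst (prod_decode b)"

text \<open>The oracle \<open>q\<close> is the join of a name and the characteristic function of a
  copy \<open>B\<close>: odd positions ask about membership in \<open>B\<close>, even ones give
  colors. This point supplies the color of \<open>B\<close>, which is not known in advance.\<close>

definition first_point :: "(nat \<Rightarrow> nat) \<Rightarrow> nat" where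
  "first_point q = (LEAST b. q (2 * b + 1) = 1)"

text \<open>The next point is compared with every point of the solution up to \<open>h\<close> instead of with the points
  chosen before, so the recursion only has to remember the last point.\<close>

definition admissible :: "(nat \<Rightarrow> nat) \<Rightarrow> nat \<Rightarrow> nat \<Rightarrow> bool" where
  "admissible q h b \<longleftrightarrow> q (2 * b + 1) = 1 \<and> h < column b \<and> (\<forall>b'\<le>h. q (2 * b' + 1) = 1 \<longrightarrow>
     q (2 * prod_encode (column b', column b - Suc (column b'))) = q (2 * first_point q))"

definition next_point :: "(nat \<Rightarrow> nat) \<Rightarrow> nat \<Rightarrow> nat" where
  "next_point q h = (LEAST b. admissible q h b)"

definition point :: "(nat \<Rightarrow> nat) \<Rightarrow> nat \<Rightarrow> nat" where
  "point q n = rec_nat (first_point q) (\<lambda>_. next_point q) n"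

text \<open>The bound on \<open>j\<close> keeps the search finite and loses nothing: the columns of
  successive points increase strictly, so the \<open>j\<close>-th column is at least
  \<open>j\<close>.\<close>

definition column_set :: "(nat \<Rightarrow> nat) \<Rightarrow> nat \<Rightarrow> nat" where
  "column_set q n = of_bool (\<exists>j\<le>n. column (point q j) = n)"

lemma computable_on_column:
  "computable_on S k A \<Longrightarrow> computable_on S k (\<lambda>p xs. column (A p xs))"
  unfolding column_def by (rule computable_on_fst_prod_decode)

lemma computable_on_column_set:
  assumes first: "\<And>q. q \<in> S \<Longrightarrow> \<exists>b. q (2 * b + 1) = 1"
    and "next": "\<And>q h. q \<in> S \<Longrightarrow> \<exists>b. admissible q h b"
  shows "computable_on S 1 (\<lambda>q xs. column_set q (xs ! 0))"
proof -
  note intros = computable_intros computable_on_oracle computable_on_column computable_on_prod_encode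
  have 1: "computable_on S k (\<lambda>q xs. first_point q)" for k
    unfolding first_point_def
  proof (rule computable_on_Least)
    show "decidable_on S (Suc k) (\<lambda>p xs. p (2 * xs ! 0 + 1) = 1)" by (intro intros; simp)
  qed (use first in blast)
  have 2: "computable_on S 1 (\<lambda>q xs. next_point q (xs ! 0))"
    unfolding next_point_def
  proof (rule computable_on_Least)
    show "decidable_on S (Suc 1) (\<lambda>p xs. admissible p (tl xs ! 0) (xs ! 0))"
      unfolding admissible_def by (intro intros 1; simp)
  qed (use "next" in blast)
  have 3: "computable_on S 1 (\<lambda>q xs. point q (xs ! 0))"
    unfolding point_def by (intro computable_on_rec_nat computable_on_comp1[OF 2] intros 1; simp)
  show ?thesis
    unfolding column_set_def by (intro intros computable_on_comp1[OF 3]; simp)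
qed

text \<open>Each column met by \<open>B\<close> contains infinitely many points of the color
  \<open>i\<close> of \<open>B\<close>, hence has limit color \<open>i\<close>. So a point of
  \<open>B\<close> in a column far enough out is compatible with finitely many earlier ones, and the
  greedy search never gets stuck.\<close>

lemma column_set_correct:
  assumes stable: "\<And>a. \<exists>j. limit_color p a j" and copy: "mono_copy_E UNIV standard_rel p B"
    and q: "q = p \<oplus>\<^sub>J indicator B"
  shows "\<exists>b. q (2 * b + 1) = 1" and "\<exists>b. admissible q h b"
    and "\<exists>H j. infinite H \<and> mono_pairs p j H \<and> column_set q = indicator H"
proof -
  note copy' = copy[unfolded mono_copy_E_iff[OF presentation_standard]]
  have inf: "infinite {y \<in> B. (x, y) \<in> standard_rel}" if "x \<in> B" for x using copy' that by simp
  have new: "\<exists>x\<in>B. \<forall>y\<in>F. (y, x) \<notin> standard_rel" if "finite F" for F using copy' that by simp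
  obtain i where i: "\<And>x. x \<in> B \<Longrightarrow> p x = i" using copy unfolding mono_copy_E_def by blast
  have qB: "q (2 * b + 1) = 1 \<longleftrightarrow> b \<in> B" and qp: "q (2 * b) = p b" for b
    unfolding q by (auto simp: join_def indicator_def)
  have "B \<noteq> {}" using new[of "{}"] by blast
  then show "\<exists>b. q (2 * b + 1) = 1" unfolding qB by blast
  then have first: "first_point q \<in> B" unfolding first_point_def qB by (auto intro: LeastI)
  then have qi: "q (2 * first_point q) = i" unfolding qp by (rule i)
  have lim: "limit_color p (column b) i" if "b \<in> B" for b
  proof -
    obtain j where j: "limit_color p (column b) j" using stable by blast
    then obtain N where N: "\<And>m. m \<ge> N \<Longrightarrow> pair_color p (column b) m = j" unfolding limit_color_def by blast
    have "\<not> {y \<in> B. (b, y) \<in> standard_rel} \<subseteq> (\<lambda>m. prod_encode (column b, m)) ` {..<N}"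
      using inf[OF that] finite_subset by blast
    then obtain y where y: "y \<in> B" "(b, y) \<in> standard_rel" "y \<notin> (\<lambda>m. prod_encode (column b, m)) ` {..<N}"
      by blast
    define m where "m = snd (prod_decode y)"
    have y_eq: "y = prod_encode (column b, m)"
      using y(2) unfolding standard_rel_def column_def m_def by simp
    then have "N \<le> m" using y(3) by (meson image_eqI lessThan_iff not_le)
    \<comment> \<open>The point with second coordinate \<open>m\<close> carries the color of the
      pair whose larger element is \<open>m + Suc (column b)\<close>, which is past \<open>N\<close>
      as well.\<close>
    then have "pair_color p (column b) (m + Suc (column b)) = j" by (intro N) simp
    then have "p y = j" unfolding pair_color_def y_eq by simp
    then show ?thesis using i[OF y(1)] j by simp
  qed
  show adm: "\<exists>b. admissible q h b" for h
  proof -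
    have "\<forall>b. \<exists>N. b \<in> B \<longrightarrow> (\<forall>m\<ge>N. pair_color p (column b) m = i)"
      using lim unfolding limit_color_def by blast
    then obtain N where N: "\<And>b m. b \<in> B \<Longrightarrow> m \<ge> N b \<Longrightarrow> pair_color p (column b) m = i" by metis
    \<comment> \<open>\<open>M\<close> lies beyond \<open>h\<close> and beyond the places where the
      columns of all points of \<open>B\<close> up to \<open>h\<close> have settled.\<close>
    obtain M where M: "\<forall>n\<in>insert h (N ` {..h}). n < M" using finite_nat_set_iff_bounded[of "insert h (N ` {..h})"] by auto
    obtain b where b: "b \<in> B" "\<forall>y\<in>(\<lambda>v. prod_encode (v, 0)) ` {..M}. (y, b) \<notin> standard_rel"
      using new[of "(\<lambda>v. prod_encode (v, 0)) ` {..M}"] by auto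
    have "M < column b"
      using b(2) unfolding standard_rel_def column_def by (auto simp: not_le[symmetric])
    moreover have "q (2 * prod_encode (column b', column b - Suc (column b'))) = i"
      if "b' \<le> h" "b' \<in> B" for b'
    proof -
      have "N b' < M" using M that(1) by simp
      then have "pair_color p (column b') (column b) = i"
        using N[OF that(2)] \<open>M < column b\<close> by simp
      then show ?thesis unfolding qp pair_color_def .
    qed
    ultimately have "admissible q h b"
      using b(1) M unfolding admissible_def qB qi by auto
    then show ?thesis ..
  qed
  have point_0: "point q 0 = first_point q" and point_Suc: "point q (Suc n) = next_point q (point q n)" for n
    unfolding point_def by simp_all
  have step: "admissible q (point q n) (point q (Suc n))" for n
    unfolding point_Suc next_point_def by (rule LeastI_ex[OF adm])
  have in_B: "point q n \<in> B" for n
    by (cases n) (use first step qB point_0 in \<open>auto simp: admissible_def\<close>)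
  have col_le: "column b \<le> b" for b
    unfolding column_def using le_prod_encode_1[of "fst (prod_decode b)" "snd (prod_decode b)"] by simp
  have less: "point q n < column (point q (Suc n))" for n using step[of n] unfolding admissible_def by simp
  then have "column (point q n) < column (point q (Suc n))" for n using le_less_trans[OF col_le] by blast
  then have mono: "strict_mono (\<lambda>n. column (point q n))" by (simp add: strict_mono_Suc_iff)
  show "\<exists>H j. infinite H \<and> mono_pairs p j H \<and> column_set q = indicator H"
  proof (intro exI conjI)
    show "infinite (range (\<lambda>n. column (point q n)))"
      using mono by (simp add: range_inj_infinite strict_mono_imp_inj_on)
    show "mono_pairs p i (range (\<lambda>n. column (point q n)))"
      unfolding mono_pairs_def
    proof (intro ballI impI)
      fix a b assume "a \<in> range (\<lambda>n. column (point q n))" "b \<in> range (\<lambda>n. column (point q n))" "a < b"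
      then obtain m n where ab: "a = column (point q m)" "b = column (point q n)" by blast
      then have "m < n" using \<open>a < b\<close> strict_mono_less[OF mono, of m n] by simp
      then obtain l where l: "n = Suc l" "m \<le> l" by (cases n) auto
      \<comment> \<open>A point is at least its column, so the points increase. Hence the
        \<open>m\<close>-th point is among those up to \<open>point q l\<close> with which the next
        point was compared.\<close>
      have "point q m \<le> point q l"
        using l(2) by (rule lift_Suc_mono_le[rotated]) (meson col_le less less_imp_le order_trans)
      then have "q (2 * prod_encode (a, b - Suc a)) = i"
        using step[of l] in_B qi unfolding admissible_def qB ab l(1) by simp
      then show "pair_color p a b = i" unfolding qp pair_color_def .
    qed
    show "column_set q = indicator (range (\<lambda>n. column (point q n)))"
    proof
      fix n
      have "(\<exists>j\<le>n. column (point q j) = n) \<longleftrightarrow> n \<in> range (\<lambda>n. column (point q n))"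
        using strict_mono_imp_increasing[OF mono] by blast
      then show "column_set q n = indicator (range (\<lambda>n. column (point q n))) n"
        unfolding column_set_def indicator_def by simp
    qed
  qed
qed

theorem SRT2_le_Ind_E: "SRT2 k \<le>\<^sub>W Ind_E k"
proof -
  have "computable_on UNIV 1 (\<lambda>p xs. instance_name UNIV standard_rel p (xs ! 0))"
    unfolding instance_name_standard
    by (intro computable_intros computable_on_oracle computable_on_div2 decidable_on_even
        computable_on_fst_prod_decode computable_on_snd_prod_decode; simp)
  then obtain \<Delta> where \<Delta>: "\<And>p. functional \<Delta> p (instance_name UNIV standard_rel p)"
    using computable_on_functional[of UNIV "instance_name UNIV standard_rel"] by auto
  \<comment> \<open>The backward functional only has to be total on joins of a stable instance with
    a monochromatic copy; on these its searches succeed.\<close>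
  define S where "S = {p \<oplus>\<^sub>J indicator B | p B.
    (\<forall>a. \<exists>j. limit_color p a j) \<and> mono_copy_E UNIV standard_rel p B}"
  have "computable_on S 1 (\<lambda>q xs. column_set q (xs ! 0))"
    using column_set_correct(1,2) unfolding S_def by (intro computable_on_column_set) blast+
  then obtain \<Psi> where \<Psi>: "\<And>q. q \<in> S \<Longrightarrow> functional \<Psi> q (column_set q)"
    using computable_on_functional[of S column_set] by auto
  show ?thesis unfolding weihrauch_le_def
  proof (intro exI ballI)
    fix p assume "p \<in> Domain (SRT2 k)"
    then obtain c where c: "p = coloring_name c" "c \<in> [UNIV]\<^bsup>2\<^esup> \<rightarrow> {..<k}" "stable_coloring c"
      unfolding Domain_SRT2 by blast
    have lim: "\<exists>j. limit_color p a j" for a using stable_coloring_limit[OF c(3)] c(1) by simp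
    have "instance_name UNIV standard_rel p \<in> Domain (Ind_E k)"
      unfolding Domain_Ind_E using presentation_standard coloring_name_bound[OF c(2)] c(1) by blast
    moreover have "\<exists>y\<in>SRT2 k `` {p}. functional \<Psi> (p \<oplus>\<^sub>J q) y"
      if q: "q \<in> Ind_E k `` {instance_name UNIV standard_rel p}" for q
    proof -
      obtain B where B: "q = indicator B" "mono_copy_E UNIV standard_rel p B"
        using q unfolding Ind_E_def by (auto simp: instance_name_inject)
      obtain H j where H: "infinite H" "mono_pairs p j H" "column_set (p \<oplus>\<^sub>J q) = indicator H"
        using column_set_correct(3)[OF lim B(2)] B(1) by blast
      have "(p, indicator H) \<in> SRT2 k"
        unfolding SRT2_def using c H(1,2) homogeneous_iff_mono_pairs by blast
      moreover have "p \<oplus>\<^sub>J q \<in> S" unfolding S_def using lim B by blast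
      ultimately show ?thesis using \<Psi> H(3) by (metis Image_singleton_iff)
    qed
    ultimately show "\<exists>x\<in>Domain (Ind_E k). functional \<Delta> p x \<and>
        (\<forall>q\<in>Ind_E k `` {x}. \<exists>y\<in>SRT2 k `` {p}. functional \<Psi> (p \<oplus>\<^sub>J q) y)"
      using \<Delta> by blast
  qed
qed

section \<open>Points picked for pairs\<close>

definition leader_above :: "(nat \<Rightarrow> nat) \<Rightarrow> nat \<Rightarrow> nat" where
  "leader_above p x = (LEAST d. x \<le> d \<and> p (4 * d) = 1 \<and>
     (\<forall>e\<le>d. p (4 * prod_encode (e, d) + 2) = 1 \<longrightarrow> e = d))"

text \<open>The class assigned to \<open>x\<close> is that of the first leader from \<open>x\<close>
  on, a leader being the least element of its class. Positions \<open>4 * d\<close> and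
  \<open>4 * z + 2\<close> of an instance hold its domain and its relation, so leaders can be
  recognized. Different \<open>x\<close> may share a class, but the leaders tend to infinity with
  \<open>x\<close>.\<close>

definition pick :: "(nat \<Rightarrow> nat) \<Rightarrow> nat \<Rightarrow> nat \<Rightarrow> nat" where
  "pick p x y = (LEAST d. y \<le> d \<and> p (4 * prod_encode (leader_above p x, d) + 2) = 1)"

definition pick_coloring :: "(nat \<Rightarrow> nat) \<Rightarrow> nat \<Rightarrow> nat" where
  "pick_coloring p n = p (2 * pick p (fst (prod_decode n))
     (Suc (fst (prod_decode n) + snd (prod_decode n))) + 1)"

text \<open>Both quantifiers may be bounded by \<open>b\<close>, since the point picked for
  \<open>x < y\<close> is at least \<open>y\<close>.\<close>

definition picked :: "(nat \<Rightarrow> nat) \<Rightarrow> nat \<Rightarrow> nat" where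
  "picked q b = of_bool (\<exists>y\<le>b. \<exists>x\<le>b. x < y \<and> q (2 * x + 1) = 1 \<and> q (2 * y + 1) = 1 \<and>
     pick (\<lambda>n. q (2 * n)) x y = b)"

text \<open>\<open>\<pi> q\<close> stands for the instance contained in the oracle \<open>q\<close>:
  the forward functional has the instance itself as its oracle, the backward functional has it as
  the even half of a join.\<close>

lemma computable_on_pick:
  assumes \<pi>: "computable_on S 1 (\<lambda>q xs. \<pi> q (xs ! 0))"
    and ex1: "\<And>q x. q \<in> S \<Longrightarrow> \<exists>d. x \<le> d \<and> \<pi> q (4 * d) = 1 \<and>
       (\<forall>e\<le>d. \<pi> q (4 * prod_encode (e, d) + 2) = 1 \<longrightarrow> e = d)"
    and ex2: "\<And>q x y. q \<in> S \<Longrightarrow> \<exists>d. y \<le> d \<and> \<pi> q (4 * prod_encode (leader_above (\<pi> q) x, d) + 2) = 1"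
  shows "computable_on S 2 (\<lambda>q xs. pick (\<pi> q) (xs ! 0) (xs ! 1))"
proof -
  note intros = computable_intros computable_on_comp1[OF \<pi>] computable_on_prod_encode
  have 1: "computable_on S 1 (\<lambda>q xs. leader_above (\<pi> q) (xs ! 0))"
    unfolding leader_above_def
  proof (rule computable_on_Least)
    show "decidable_on S (Suc 1) (\<lambda>q xs. tl xs ! 0 \<le> xs ! 0 \<and> \<pi> q (4 * xs ! 0) = 1 \<and>
        (\<forall>e\<le>xs ! 0. \<pi> q (4 * prod_encode (e, xs ! 0) + 2) = 1 \<longrightarrow> e = xs ! 0))"
      by (intro intros; simp)
  qed (use ex1 in blast)
  show ?thesis
    unfolding pick_def
  proof (rule computable_on_Least)
    show "decidable_on S (Suc 2) (\<lambda>q xs. tl xs ! 1 \<le> xs ! 0 \<and>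
        \<pi> q (4 * prod_encode (leader_above (\<pi> q) (tl xs ! 0), xs ! 0) + 2) = 1)"
      by (intro intros computable_on_comp1[OF 1]; simp)
  qed (use ex2 in blast)
qed

context
  fixes D :: "nat set" and R :: "(nat \<times> nat) set" and c :: "nat \<Rightarrow> nat"
  assumes pres: "presentation_E D R"
begin

lemma instance_name_eq_1:
  "instance_name D R c (4 * d) = 1 \<longleftrightarrow> d \<in> D"
  "instance_name D R c (4 * prod_encode z + 2) = 1 \<longleftrightarrow> z \<in> R"
proof -
  have "prod_encode z \<in> prod_encode ` R \<longleftrightarrow> z \<in> R"
    by (simp add: inj_image_mem_iff[OF inj_prod_encode])
  then show "instance_name D R c (4 * d) = 1 \<longleftrightarrow> d \<in> D"
    "instance_name D R c (4 * prod_encode z + 2) = 1 \<longleftrightarrow> z \<in> R"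
    unfolding instance_name_nth indicator_def by auto
qed

lemma
  shows rel_sym: "(x, y) \<in> R \<Longrightarrow> (y, x) \<in> R" and rel_trans: "(x, y) \<in> R \<Longrightarrow> (y, z) \<in> R \<Longrightarrow> (x, z) \<in> R"
    and rel_refl: "x \<in> D \<Longrightarrow> (x, x) \<in> R" and rel_sub: "(x, y) \<in> R \<Longrightarrow> x \<in> D \<and> y \<in> D"
    and rel_inf: "x \<in> D \<Longrightarrow> \<exists>d\<ge>n. (x, d) \<in> R"
    and rel_new: "finite F \<Longrightarrow> \<exists>x\<in>D. \<forall>y\<in>F. (y, x) \<notin> R"
proof -
  note pres' = pres[unfolded presentation_E_iff E_like_def]
  note eq = conjunct1[OF conjunct2[OF pres']]
  show "(x, y) \<in> R \<Longrightarrow> (y, x) \<in> R" "(x, y) \<in> R \<Longrightarrow> (y, z) \<in> R \<Longrightarrow> (x, z) \<in> R" "x \<in> D \<Longrightarrow> (x, x) \<in> R"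
    using eq unfolding equiv_def by (auto dest: symD transD refl_onD)
  show "x \<in> D \<and> y \<in> D" if "(x, y) \<in> R" using conjunct1[OF pres'] that by blast
  show "\<exists>d\<ge>n. (x, d) \<in> R" if "x \<in> D"
    using bspec[OF conjunct1[OF conjunct2[OF conjunct2[OF pres']]] that]
    unfolding infinite_nat_iff_unbounded_le by auto
  show "\<exists>x\<in>D. \<forall>y\<in>F. (y, x) \<notin> R" if "finite F"
    by (rule mp[OF spec[OF conjunct2[OF conjunct2[OF conjunct2[OF pres']]]] that])
qed

lemma leader_exists: "\<exists>d\<ge>x. d \<in> D \<and> (\<forall>e\<le>d. (e, d) \<in> R \<longrightarrow> e = d)"
proof -
  obtain d0 where d0: "d0 \<in> D" "\<forall>y\<in>{..<x}. (y, d0) \<notin> R" using rel_new[of "{..<x}"] by auto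
  \<comment> \<open>The class of \<open>d0\<close> contains no number below \<open>x\<close>, so its
    least element is a leader and at least \<open>x\<close>.\<close>
  define d where "d = (LEAST d. (d, d0) \<in> R)"
  have d: "(d, d0) \<in> R" unfolding d_def using rel_refl[OF d0(1)] by (rule LeastI)
  have "e = d" if "e \<le> d" "(e, d) \<in> R" for e
  proof -
    have "(e, d0) \<in> R" using rel_trans[OF that(2) d] .
    then have "d \<le> e" unfolding d_def by (rule Least_le)
    then show ?thesis using that(1) by simp
  qed
  moreover have "x \<le> d" using d d0(2) by (meson lessThan_iff not_le)
  ultimately show ?thesis using rel_sub[OF d] by blast
qed

lemma leader_above:
  defines "l \<equiv> leader_above (instance_name D R c)"
  shows "x \<le> l x" and "l x \<in> D" and "(e, l x) \<in> R \<Longrightarrow> l x \<le> e"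
proof -
  have l: "x \<le> l x \<and> l x \<in> D \<and> (\<forall>e\<le>l x. (e, l x) \<in> R \<longrightarrow> e = l x)"
    unfolding l_def leader_above_def instance_name_eq_1 by (rule LeastI_ex) (rule leader_exists)
  then show "x \<le> l x" and "l x \<in> D" by blast+
  show "l x \<le> e" if "(e, l x) \<in> R" using l that by (cases "e \<le> l x") auto
qed

lemma pick:
  shows "y \<le> pick (instance_name D R c) x y"
    and "(leader_above (instance_name D R c) x, pick (instance_name D R c) x y) \<in> R"
proof -
  have "y \<le> pick (instance_name D R c) x y \<and>
      (leader_above (instance_name D R c) x, pick (instance_name D R c) x y) \<in> R"
    unfolding pick_def instance_name_eq_1 by (rule LeastI_ex) (rule rel_inf[OF leader_above(2)])
  then show "y \<le> pick (instance_name D R c) x y"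
    and "(leader_above (instance_name D R c) x, pick (instance_name D R c) x y) \<in> R" by blast+
qed

text \<open>With \<open>x\<close> fixed, letting \<open>y\<close> run through \<open>H\<close> gives
  arbitrarily large points of one class; letting \<open>x\<close> run through \<open>H\<close> gives
  classes with arbitrarily large leaders. All these points inherit the color \<open>j\<close> of the
  pairs.\<close>

lemma pick_solution:
  assumes "infinite H" and mono: "mono_pairs (pick_coloring (instance_name D R c)) j H"
  shows "\<exists>B. mono_copy_E D R c B \<and> picked (instance_name D R c \<oplus>\<^sub>J indicator H) = indicator B"
proof -
  let ?p = "instance_name D R c"
  define B where "B = {pick ?p x y | x y. x \<in> H \<and> y \<in> H \<and> x < y}"
  have color: "c (pick ?p x y) = j" if "x \<in> H" "y \<in> H" "x < y" for x y
  proof -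
    have "pair_color (pick_coloring ?p) x y = c (pick ?p x y)"
      using that(3) unfolding pair_color_def pick_coloring_def instance_name_nth by simp
    then show ?thesis using mono that unfolding mono_pairs_def by auto
  qed
  have "\<exists>n\<ge>m. n \<in> {y \<in> B. (pick ?p a b, y) \<in> R}" if a: "a \<in> H" for a b m
  proof -
    obtain y where y: "y \<in> H" "y > max a m" using assms(1) infinite_nat_iff_unbounded by blast
    have "pick ?p a y \<in> B" using a y unfolding B_def by auto
    moreover have "(pick ?p a b, pick ?p a y) \<in> R" using pick(2) rel_sym rel_trans by blast
    moreover have "m \<le> pick ?p a y" using pick(1)[of y a] y(2) by simp
    ultimately show ?thesis by blast
  qed
  then have inf: "infinite {y \<in> B. (x, y) \<in> R}" if "x \<in> B" for x
    using that unfolding infinite_nat_iff_unbounded_le by (auto simp: B_def)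
  have new: "\<exists>x\<in>B. \<forall>y\<in>F. (y, x) \<notin> R" if F: "finite F" for F
  proof -
    obtain M where M: "\<forall>n\<in>F. n < M" using F finite_nat_set_iff_bounded by blast
    obtain a where a: "a \<in> H" "a > M" using assms(1) infinite_nat_iff_unbounded by blast
    obtain b where b: "b \<in> H" "b > a" using assms(1) infinite_nat_iff_unbounded by blast
    have "(y, pick ?p a b) \<notin> R" if "y \<in> F" for y
    proof
      assume "(y, pick ?p a b) \<in> R"
      then have "(y, leader_above ?p a) \<in> R" using pick(2) rel_sym rel_trans by blast
      then have "a \<le> y" using leader_above(1,3) le_trans by blast
      then show False using M a(2) that by auto
    qed
    then show ?thesis using a(1) b unfolding B_def by blast
  qed
  have "B \<subseteq> D" using pick(2) rel_sub unfolding B_def by blast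
  then have "mono_copy_E D R c B"
    unfolding mono_copy_E_iff[OF pres] using inf new color by (auto simp: B_def)
  moreover have "picked (?p \<oplus>\<^sub>J indicator H) = indicator B"
  proof
    fix b
    have "(\<lambda>n. (?p \<oplus>\<^sub>J indicator H) (2 * n)) = ?p" by (simp add: join_def)
    moreover have "(?p \<oplus>\<^sub>J indicator H) (2 * x + 1) = 1 \<longleftrightarrow> x \<in> H" for x
      by (simp add: join_def indicator_def)
    ultimately have "picked (?p \<oplus>\<^sub>J indicator H) b =
        of_bool (\<exists>y\<le>b. \<exists>x\<le>b. x < y \<and> x \<in> H \<and> y \<in> H \<and> pick ?p x y = b)"
      unfolding picked_def by simp
    also have "(\<exists>y\<le>b. \<exists>x\<le>b. x < y \<and> x \<in> H \<and> y \<in> H \<and> pick ?p x y = b) \<longleftrightarrow> b \<in> B"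
    proof
      assume "b \<in> B"
      then obtain x y where xy: "x \<in> H" "y \<in> H" "x < y" "pick ?p x y = b" unfolding B_def by blast
      then have "y \<le> b" using pick(1) by blast
      then show "\<exists>y\<le>b. \<exists>x\<le>b. x < y \<and> x \<in> H \<and> y \<in> H \<and> pick ?p x y = b"
        using xy by (intro exI[of _ y] exI[of _ x] conjI) simp_all
    qed (auto simp: B_def)
    finally show "picked (?p \<oplus>\<^sub>J indicator H) b = indicator B b" by (cases "b \<in> B") simp_all
  qed
  ultimately show ?thesis by blast
qed

end

theorem Ind_E_le_RT2: "Ind_E k \<le>\<^sub>W RT2 k"
proof -
  \<comment> \<open>The searches for leaders and points terminate on names of presentations, so
    totality is asked for only on \<open>I\<close> and on joins whose first half is in
    \<open>I\<close>.\<close>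
  define I where "I = {instance_name D R c | D R c. presentation_E D R}"
  define S where "S = {p \<oplus>\<^sub>J q | p q. p \<in> I}"
  have ex1: "\<exists>d. x \<le> d \<and> p (4 * d) = 1 \<and> (\<forall>e\<le>d. p (4 * prod_encode (e, d) + 2) = 1 \<longrightarrow> e = d)"
    if pI: "p \<in> I" for p x
  proof -
    obtain D R c where p: "p = instance_name D R c" and pres: "presentation_E D R"
      using pI unfolding I_def by blast
    show ?thesis unfolding p instance_name_eq_1[OF pres] by (rule leader_exists[OF pres])
  qed
  have ex2: "\<exists>d. y \<le> d \<and> p (4 * prod_encode (leader_above p x, d) + 2) = 1" if pI: "p \<in> I" for p x y
  proof -
    obtain D R c where p: "p = instance_name D R c" and pres: "presentation_E D R"
      using pI unfolding I_def by blast
    show ?thesis unfolding p instance_name_eq_1[OF pres] using pick[OF pres] by blast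
  qed
  have "computable_on I 2 (\<lambda>q xs. pick q (xs ! 0) (xs ! 1))"
    by (intro computable_on_pick computable_on_oracle computable_intros ex1 ex2) simp_all
  note pick_I = computable_on_comp2[OF this]
  have "computable_on I 1 (\<lambda>p xs. pick_coloring p (xs ! 0))"
    unfolding pick_coloring_def
    by (intro pick_I computable_intros computable_on_oracle computable_on_fst_prod_decode
        computable_on_snd_prod_decode; simp)
  then obtain \<Delta> where \<Delta>: "\<And>p. p \<in> I \<Longrightarrow> functional \<Delta> p (pick_coloring p)"
    using computable_on_functional[of I pick_coloring] by blast
  have left: "(\<lambda>n. q (2 * n)) \<in> I" if "q \<in> S" for q
    using that unfolding S_def by (auto simp: join_def)
  have "computable_on S 2 (\<lambda>q xs. pick (\<lambda>n. q (2 * n)) (xs ! 0) (xs ! 1))"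
  proof (rule computable_on_pick)
    show "computable_on S 1 (\<lambda>q xs. q (2 * xs ! 0))"
      by (intro computable_intros computable_on_oracle) simp
  qed (use ex1[OF left] ex2[OF left] in blast)+
  note pick_S = computable_on_comp2[OF this]
  have "computable_on S 1 (\<lambda>q xs. picked q (xs ! 0))"
    unfolding picked_def by (intro pick_S computable_intros computable_on_oracle; simp)
  then obtain \<Psi> where \<Psi>: "\<And>q. q \<in> S \<Longrightarrow> functional \<Psi> q (picked q)"
    using computable_on_functional[of S picked] by blast
  show ?thesis unfolding weihrauch_le_def
  proof (intro exI ballI)
    fix p assume "p \<in> Domain (Ind_E k)"
    then obtain D R c where p: "p = instance_name D R c" "presentation_E D R" "c \<in> D \<rightarrow> {..<k}"
      unfolding Domain_Ind_E by blast
    have pI: "p \<in> I" using p unfolding I_def by blast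
    \<comment> \<open>\<open>Min\<close> and \<open>Max\<close> recover the ordered pair from a
      two-element set; the name of \<open>d\<close> is the output of the forward functional.\<close>
    define d where "d e = c (pick p (Min e) (Max e))" for e
    have name: "coloring_name d = pick_coloring p"
      unfolding fun_eq_iff coloring_name_def pick_coloring_def d_def p(1) instance_name_nth
      by (simp add: case_prod_beta max_def min_def)
    have "pick p x y \<in> D" for x y using pick(2)[OF p(2)] rel_sub[OF p(2)] p(1) by blast
    then have "d \<in> [UNIV]\<^bsup>2\<^esup> \<rightarrow> {..<k}" using p(3) unfolding d_def by blast
    then have "pick_coloring p \<in> Domain (RT2 k)" unfolding Domain_RT2 name[symmetric] by blast
    moreover have "\<exists>y\<in>Ind_E k `` {p}. functional \<Psi> (p \<oplus>\<^sub>J q) y"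
      if q: "q \<in> RT2 k `` {pick_coloring p}" for q
    proof -
      obtain c' H where H: "pick_coloring p = coloring_name c'" "q = indicator H" "infinite H" "homogeneous c' H"
        using q unfolding RT2_def by auto
      then obtain j where "mono_pairs (pick_coloring p) j H" using homogeneous_iff_mono_pairs by auto
      then obtain B where B: "mono_copy_E D R c B" "picked (p \<oplus>\<^sub>J q) = indicator B"
        using pick_solution[OF p(2) H(3)] p(1) H(2) by blast
      have "(p, indicator B) \<in> Ind_E k" unfolding Ind_E_def using p B(1) by blast
      moreover have "p \<oplus>\<^sub>J q \<in> S" unfolding S_def using pI by blast
      ultimately show ?thesis using \<Psi>[of "p \<oplus>\<^sub>J q"] B(2) by auto
    qed
    ultimately show "\<exists>x\<in>Domain (RT2 k). functional \<Delta> p x \<and>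
        (\<forall>q\<in>RT2 k `` {x}. \<exists>y\<in>Ind_E k `` {p}. functional \<Psi> (p \<oplus>\<^sub>J q) y)"
      using \<Delta>[OF pI] by blast
  qed
qed

section \<open>Diagonalization against limits\<close>

instance program :: countable
  by countable_datatype

text \<open>The sets are treated in order. Those before \<open>e\<close> have reserved at most
  \<open>2 * e\<close> numbers, so among \<open>2 * e + 2\<close> elements of \<open>D e\<close> two
  are still free and can be given different colors.\<close>

lemma split_sets:
  fixes D :: "nat \<Rightarrow> nat set"
  shows "\<exists>f :: nat \<Rightarrow> nat. (\<forall>x. f x < 2) \<and> (\<forall>e<n. \<forall>m. 2 * e + 2 \<le> card (D e \<inter> {..<m}) \<longrightarrow>
    (\<exists>x\<in>D e \<inter> {..<m}. \<exists>y\<in>D e \<inter> {..<m}. f x = 0 \<and> f y = 1))"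
proof -
  \<comment> \<open>\<open>U\<close> collects the numbers reserved so far; as the witnesses lie in
    \<open>U\<close>, recoloring outside of \<open>U\<close> does not disturb earlier sets.\<close>
  have "\<exists>f :: nat \<Rightarrow> nat. \<exists>U. (\<forall>x. f x < 2) \<and> finite U \<and> card U \<le> 2 * n \<and>
    (\<forall>e<n. \<forall>m. 2 * e + 2 \<le> card (D e \<inter> {..<m}) \<longrightarrow>
      (\<exists>x\<in>D e \<inter> {..<m} \<inter> U. \<exists>y\<in>D e \<inter> {..<m} \<inter> U. f x = 0 \<and> f y = 1))"
  proof (induction n)
    case 0
    show ?case by (intro exI[of _ "\<lambda>_. 0"] exI[of _ "{}"]) simp
  next
    case (Suc n)
    then obtain f :: "nat \<Rightarrow> nat" and U where f: "\<And>x. f x < 2" and U: "finite U" "card U \<le> 2 * n"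
      and sep: "\<And>e m. e < n \<Longrightarrow> 2 * e + 2 \<le> card (D e \<inter> {..<m}) \<Longrightarrow>
        \<exists>x\<in>D e \<inter> {..<m} \<inter> U. \<exists>y\<in>D e \<inter> {..<m} \<inter> U. f x = 0 \<and> f y = 1" by blast
    show ?case
    proof (cases "\<exists>m. 2 * n + 2 \<le> card (D n \<inter> {..<m})")
      case False
      then show ?thesis using f U sep
        by (intro exI[of _ f] exI[of _ U]) (auto simp: less_Suc_eq)
    next
      case True
      \<comment> \<open>Two free elements below the least suitable bound serve for all larger bounds
        at once.\<close>
      define m0 where "m0 = (LEAST m. 2 * n + 2 \<le> card (D n \<inter> {..<m}))"
      have "2 * n + 2 \<le> card (D n \<inter> {..<m0})" unfolding m0_def using True by (rule LeastI_ex)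
      then have "2 \<le> card (D n \<inter> {..<m0} - U)"
        using U(2) diff_card_le_card_Diff[OF U(1), of "D n \<inter> {..<m0}"] by linarith
      then obtain Z where "Z \<subseteq> D n \<inter> {..<m0} - U" "card Z = 2" using obtain_subset_with_card_n by metis
      then obtain x y where xy: "x \<in> D n \<inter> {..<m0} - U" "y \<in> D n \<inter> {..<m0} - U" "x \<noteq> y"
        by (auto simp: card_2_iff)
      define f' where "f' = f(x := 0, y := 1)"
      define U' where "U' = insert x (insert y U)"
      have old: "f' z = f z" if "z \<in> U" for z using xy that unfolding f'_def by auto
      have "\<exists>a\<in>D e \<inter> {..<m} \<inter> U'. \<exists>b\<in>D e \<inter> {..<m} \<inter> U'. f' a = 0 \<and> f' b = 1"
        if e: "e < Suc n" and m: "2 * e + 2 \<le> card (D e \<inter> {..<m})" for e m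
      proof (cases "e = n")
        case True
        then have "m0 \<le> m" unfolding m0_def using m by (auto intro: Least_le)
        then show ?thesis using xy True unfolding U'_def f'_def
          by (intro bexI[of _ x] bexI[of _ y]) auto
      next
        case False
        then obtain a b where "a \<in> D e \<inter> {..<m} \<inter> U" "b \<in> D e \<inter> {..<m} \<inter> U" "f a = 0 \<and> f b = 1"
          using sep[of e m] e m by auto
        then show ?thesis using old unfolding U'_def by (intro bexI[of _ a] bexI[of _ b]) auto
      qed
      moreover have "f' z < 2" for z using f unfolding f'_def by simp
      moreover have "finite U'" "card U' \<le> 2 * Suc n"
        using U unfolding U'_def by (auto simp: card_insert_if)
      ultimately show ?thesis by blast
    qed
  qed
  then obtain f :: "nat \<Rightarrow> nat" and U where f: "\<forall>x. f x < 2"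
    and sep: "\<And>e m. e < n \<Longrightarrow> 2 * e + 2 \<le> card (D e \<inter> {..<m}) \<Longrightarrow>
      \<exists>x\<in>D e \<inter> {..<m} \<inter> U. \<exists>y\<in>D e \<inter> {..<m} \<inter> U. f x = 0 \<and> f y = 1" by blast
  have "\<exists>x\<in>D e \<inter> {..<m}. \<exists>y\<in>D e \<inter> {..<m}. f x = 0 \<and> f y = 1"
    if "e < n" "2 * e + 2 \<le> card (D e \<inter> {..<m})" for e m
    using sep[OF that] by (elim bexE) (metis IntD1)
  with f show ?thesis by blast
qed

lemma sum_le_prod_encode: "i + j \<le> prod_encode (i, j)"
proof -
  have "k \<le> triangle k" for k by (induction k) auto
  then show ?thesis unfolding prod_encode_def by (simp add: trans_le_add1)
qed

text \<open>Jockusch's diagonalization.  The column of \<open>s\<close> is chosen so as not to be constant on the first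
  few elements of the \<open>e\<close>-th approximation at stage \<open>s\<close>, which only depends on the earlier columns.\<close>

lemma diagonal_coloring:
  fixes G :: "nat \<Rightarrow> nat \<Rightarrow> (nat \<Rightarrow> nat) \<Rightarrow> nat set"
  assumes local: "\<And>e s p q. (\<forall>n. Suc n < s \<longrightarrow> p n = q n) \<Longrightarrow> G e s p = G e s q"
  shows "\<exists>p. (\<forall>n. p n < 2) \<and> (\<forall>e A j. infinite A \<longrightarrow>
    (\<forall>x. \<exists>t. \<forall>s\<ge>t. x \<in> G e s p \<longleftrightarrow> x \<in> A) \<longrightarrow> \<not> mono_pairs p j A)"
proof -
  \<comment> \<open>\<open>top n\<close> is the larger element of the pair coded by
    \<open>n\<close>; stage \<open>s\<close> of the construction fixes the colors of all pairs with
    larger element \<open>s\<close>.\<close>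
  define top where "top n = Suc (fst (prod_decode n) + snd (prod_decode n))" for n
  have top_le: "top n \<le> Suc n" for n
    using sum_le_prod_encode[of "fst (prod_decode n)" "snd (prod_decode n)"] unfolding top_def by simp
  have "\<forall>s p. \<exists>f :: nat \<Rightarrow> nat. (\<forall>x. f x < 2) \<and> (\<forall>e<s. \<forall>m. 2 * e + 2 \<le> card (G e s p \<inter> {..<m}) \<longrightarrow>
    (\<exists>x\<in>G e s p \<inter> {..<m}. \<exists>y\<in>G e s p \<inter> {..<m}. f x = 0 \<and> f y = 1))"
    by (intro allI split_sets)
  then obtain f :: "nat \<Rightarrow> (nat \<Rightarrow> nat) \<Rightarrow> nat \<Rightarrow> nat" where f2: "\<And>s p x. f s p x < 2"
    and f: "\<And>s p e m. e < s \<Longrightarrow> 2 * e + 2 \<le> card (G e s p \<inter> {..<m}) \<Longrightarrow>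
      \<exists>x\<in>G e s p \<inter> {..<m}. \<exists>y\<in>G e s p \<inter> {..<m}. f s p x = 0 \<and> f s p y = 1"
    by metis
  define P where "P = rec_nat (\<lambda>_. 0) (\<lambda>s q n. if top n = s then f s q (fst (prod_decode n)) else q n)"
  have P_Suc: "P (Suc s) n = (if top n = s then f s (P s) (fst (prod_decode n)) else P s n)" for s n
    unfolding P_def by simp
  define p where "p n = P (Suc (top n)) n" for n
  have stable: "P s n = p n" if "top n < s" for s n
    using that unfolding p_def
  proof (induction s)
    case (Suc s)
    then show ?case by (cases "top n = s") (auto simp: P_Suc)
  qed simp
  have p2: "p n < 2" for n unfolding p_def P_Suc using f2 by simp
  \<comment> \<open>An entry \<open>n\<close> with \<open>Suc n < s\<close> has
    \<open>top n < s\<close>, so it is final at stage \<open>s\<close>; this is all that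
    \<open>G e s\<close> can see.\<close>
  have G: "G e s (P s) = G e s p" for e s
    using top_le stable by (intro local) (auto intro: le_less_trans)
  have pair: "pair_color p a s = f s (P s) a" if "a < s" for a s
  proof -
    have "top (prod_encode (a, s - Suc a)) = s" using that unfolding top_def by simp
    then show ?thesis unfolding pair_color_def p_def P_Suc by simp
  qed
  have "\<not> mono_pairs p j A"
    if A: "infinite A" and lim: "\<forall>x. \<exists>t. \<forall>s\<ge>t. x \<in> G e s p \<longleftrightarrow> x \<in> A" for e A j
  proof
    assume mono: "mono_pairs p j A"
    obtain Z where Z: "Z \<subseteq> A" "finite Z" "card Z = 2 * e + 2"
      using infinite_arbitrarily_large[OF A] by blast
    obtain m where m: "\<forall>z\<in>Z. z < m" using Z(2) finite_nat_set_iff_bounded by blast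
    have card: "2 * e + 2 \<le> card (A \<inter> {..<m})"
      using Z m card_mono[of "A \<inter> {..<m}" Z] by auto
    obtain t where t: "\<And>x s. s \<ge> t x \<Longrightarrow> x \<in> G e s p \<longleftrightarrow> x \<in> A" using lim by metis
    obtain T where T: "\<forall>x\<in>t ` {..<m}. x < T" using finite_nat_set_iff_bounded[of "t ` {..<m}"] by auto
    \<comment> \<open>By stage \<open>s\<close> the approximation is correct below \<open>m\<close>.
      The column of \<open>s\<close> therefore takes both colors on elements of \<open>A\<close>
      below \<open>m\<close>, while \<open>s\<close> itself is in \<open>A\<close>.\<close>
    obtain s where s: "s \<in> A" "s > max T (max m e)" using A infinite_nat_iff_unbounded by blast
    have "t x \<le> s" if "x < m" for x using T s(2) that by (auto intro: less_imp_le less_trans)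
    then have eq: "G e s p \<inter> {..<m} = A \<inter> {..<m}" using t by auto
    obtain x y where xy: "x \<in> A \<inter> {..<m}" "y \<in> A \<inter> {..<m}" "f s (P s) x = 0" "f s (P s) y = 1"
      using f[of e s "P s" m] card s(2) unfolding G eq by auto
    have "pair_color p x s = j" "pair_color p y s = j"
      using mono xy s unfolding mono_pairs_def by auto
    then show False using xy pair s(2) by auto
  qed
  with p2 show ?thesis by blast
qed

text \<open>For fixed \<open>S\<close>, \<open>i\<close> and \<open>N\<close>, a failure of any of
  the conditions shows in finitely many values of the instance, which makes the set co-enumerable.
  \<open>N\<close> bars finitely many classes; the last condition drops the points of a class that
  come before its colors have settled within \<open>S\<close>.\<close>

definition tail_copy :: "nat set \<Rightarrow> (nat \<times> nat) set \<Rightarrow> (nat \<Rightarrow> nat) \<Rightarrow> nat set \<Rightarrow> nat \<Rightarrow> nat \<Rightarrow> nat set" where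
  "tail_copy D R c S i N =
    {d \<in> D. c d = i \<and> (\<forall>e<N. (e, d) \<notin> R) \<and> (\<forall>d'\<ge>d. (d', d) \<in> R \<longrightarrow> c d' \<in> S)}"

text \<open>\<open>S\<close> is minimal such that infinitely many classes have eventually only colors in \<open>S\<close>.  Then all but
  finitely many of these classes contain each color in \<open>S\<close> infinitely often.\<close>

lemma tail_copy_solution:
  assumes pres: "presentation_E D R" and fin: "finite (c ` D)"
  shows "\<exists>S i N. finite S \<and> mono_copy_E D R c (tail_copy D R c S i N)"
proof -
  note pres' = pres[unfolded presentation_E_iff E_like_def]
  note R = conjunct1[OF pres'] and eq = conjunct1[OF conjunct2[OF pres']]
  have inf: "infinite (R `` {x})" if "x \<in> D" for x
    using conjunct1[OF conjunct2[OF conjunct2[OF pres']]] that by (rule bspec)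
  have new: "\<exists>x\<in>D. \<forall>y\<in>F. (y, x) \<notin> R" if "finite F" for F
    by (rule mp[OF spec[OF conjunct2[OF conjunct2[OF conjunct2[OF pres']]]] that])
  have sym: "(x, y) \<in> R \<Longrightarrow> (y, x) \<in> R" and trans: "(x, y) \<in> R \<Longrightarrow> (y, z) \<in> R \<Longrightarrow> (x, z) \<in> R"
    and refl: "x \<in> D \<Longrightarrow> (x, x) \<in> R" for x y z
    using eq unfolding equiv_def by (auto dest: symD transD refl_onD)
  \<comment> \<open>Up to finitely many points, the class of \<open>r\<close> uses exactly the
    colors in \<open>C r\<close>; \<open>ok\<close> is the property for which a minimal set of
    colors is taken.\<close>
  define C where "C r = {v. infinite {d. (r, d) \<in> R \<and> c d = v}}" for r
  define ok where "ok S \<longleftrightarrow> (\<forall>F. finite F \<longrightarrow> (\<exists>r\<in>D. (\<forall>y\<in>F. (y, r) \<notin> R) \<and> C r \<subseteq> S))" for S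
  have C_sub: "C r \<subseteq> c ` D" for r
  proof
    fix v assume "v \<in> C r"
    then have "{d. (r, d) \<in> R \<and> c d = v} \<noteq> {}" unfolding C_def using finite.emptyI by (metis mem_Collect_eq)
    then show "v \<in> c ` D" using R by blast
  qed
  have "ok (c ` D)" unfolding ok_def using C_sub new by blast
  then obtain S where S: "finite S" "ok S" and min: "\<And>S'. finite S' \<Longrightarrow> ok S' \<Longrightarrow> card S \<le> card S'"
    using ex_has_least_nat[of "\<lambda>S. finite S \<and> ok S" "c ` D" card] fin by auto
  have "\<forall>v\<in>S. \<exists>F. finite F \<and> (\<forall>r\<in>D. (\<forall>y\<in>F. (y, r) \<notin> R) \<longrightarrow> \<not> C r \<subseteq> S - {v})"
  proof
    fix v assume v: "v \<in> S"
    then have "card (S - {v}) < card S" using S(1) by (intro psubset_card_mono) auto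
    then have "\<not> ok (S - {v})" using min[of "S - {v}"] S(1) by auto
    then show "\<exists>F. finite F \<and> (\<forall>r\<in>D. (\<forall>y\<in>F. (y, r) \<notin> R) \<longrightarrow> \<not> C r \<subseteq> S - {v})"
      unfolding ok_def by blast
  qed
  \<comment> \<open>By minimality, dropping \<open>v\<close> from \<open>S\<close> leaves only
    finitely many classes, and \<open>F v\<close> meets all of these. A bound \<open>N\<close> for
    all the sets \<open>F v\<close> thus bars every class whose \<open>C r\<close> is a proper
    subset of \<open>S\<close>.\<close>
  then obtain F where F: "\<And>v. v \<in> S \<Longrightarrow> finite (F v)"
    "\<And>v r. v \<in> S \<Longrightarrow> r \<in> D \<Longrightarrow> \<forall>y\<in>F v. (y, r) \<notin> R \<Longrightarrow> \<not> C r \<subseteq> S - {v}"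
    unfolding Bex_def using bchoice[of S] by (metis (no_types, lifting))
  have "finite (\<Union>v\<in>S. F v)" using F(1) S(1) by blast
  then obtain N where N: "\<forall>y\<in>\<Union>v\<in>S. F v. y < N" using finite_nat_set_iff_bounded by blast
  have C_eq: "C r = S" if r: "r \<in> D" "\<forall>e<N. (e, r) \<notin> R" "C r \<subseteq> S" for r
  proof -
    have "v \<in> C r" if "v \<in> S" for v
    proof -
      have "\<forall>y\<in>F v. (y, r) \<notin> R" using N r(2) that by blast
      then show ?thesis using F(2)[OF that r(1)] r(3) by blast
    qed
    then show ?thesis using r(3) by blast
  qed
  have C_ne: "C r \<noteq> {}" if "r \<in> D" for r
  proof
    assume "C r = {}"
    then have "finite {d. (r, d) \<in> R \<and> c d = v}" for v unfolding C_def by auto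
    then have "finite (\<Union>v\<in>c ` D. {d. (r, d) \<in> R \<and> c d = v})" using fin by blast
    moreover have "R `` {r} \<subseteq> (\<Union>v\<in>c ` D. {d. (r, d) \<in> R \<and> c d = v})" using R by auto
    ultimately show False using inf[OF that] finite_subset by blast
  qed
  obtain i where i: "i \<in> S"
  proof -
    obtain r where "r \<in> D" "C r \<subseteq> S" using S(2) unfolding ok_def by (meson finite.emptyI)
    then show ?thesis using C_ne that by blast
  qed
  define B where "B = tail_copy D R c S i N"
  have B_inf: "infinite {y \<in> B. (x, y) \<in> R}" if x: "x \<in> B" for x
  proof -
    have xD: "x \<in> D" "\<forall>e<N. (e, x) \<notin> R" and xS: "\<And>d'. d' \<ge> x \<Longrightarrow> (d', x) \<in> R \<Longrightarrow> c d' \<in> S"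
      using x unfolding B_def tail_copy_def by auto
    have "C x \<subseteq> S"
    proof
      fix v assume v: "v \<in> C x"
      show "v \<in> S"
      proof (rule ccontr)
        assume "v \<notin> S"
        then have "{d. (x, d) \<in> R \<and> c d = v} \<subseteq> {..<x}" using xS sym by (metis (mono_tags, lifting) lessThan_iff mem_Collect_eq not_le subsetI)
        then show False using v finite_subset unfolding C_def by blast
      qed
    qed
    then have "infinite {d. (x, d) \<in> R \<and> c d = i}" using C_eq[OF xD] i unfolding C_def by blast
    \<comment> \<open>Membership in \<open>B\<close> passes to all later points of color
      \<open>i\<close> in the same class.\<close>
    moreover have "{d. (x, d) \<in> R \<and> c d = i} \<subseteq> {y \<in> B. (x, y) \<in> R} \<union> {..<x}"
    proof
      fix d assume "d \<in> {d. (x, d) \<in> R \<and> c d = i}"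
      then have d: "(x, d) \<in> R" "c d = i" by auto
      have "d \<in> B" if "x \<le> d"
      proof -
        have "\<forall>e<N. (e, d) \<notin> R" using xD(2) trans sym d(1) by blast
        moreover have "c d' \<in> S" if "d \<le> d'" "(d', d) \<in> R" for d'
          using xS[of d'] that \<open>x \<le> d\<close> trans[OF that(2) sym[OF d(1)]] by simp
        ultimately show ?thesis using d R unfolding B_def tail_copy_def by blast
      qed
      then show "d \<in> {y \<in> B. (x, y) \<in> R} \<union> {..<x}" using d(1) by (cases "x \<le> d") auto
    qed
    ultimately have "infinite ({y \<in> B. (x, y) \<in> R} \<union> {..<x})" using infinite_super by blast
    then show ?thesis by simp
  qed
  have B_new: "\<exists>x\<in>B. \<forall>y\<in>F. (y, x) \<notin> R" if F: "finite F" for F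
  proof -
    have "finite (F \<union> {..<N})" using F by simp
    then obtain r where r: "r \<in> D" "\<forall>y\<in>F \<union> {..<N}. (y, r) \<notin> R" "C r \<subseteq> S"
      using S(2) unfolding ok_def by blast
    have "C r = S" using r by (intro C_eq) auto
    then have inf_i: "infinite {d. (r, d) \<in> R \<and> c d = i}" using i unfolding C_def by blast
    have "finite (\<Union>v\<in>c ` D - S. {d. (r, d) \<in> R \<and> c d = v})"
      using fin \<open>C r = S\<close> unfolding C_def by blast
    then obtain M where M: "\<forall>d\<in>\<Union>v\<in>c ` D - S. {d. (r, d) \<in> R \<and> c d = v}. d < M"
      using finite_nat_set_iff_bounded by blast
    have MS: "c d \<in> S" if "(r, d) \<in> R" "M \<le> d" for d
    proof (rule ccontr)
      assume "c d \<notin> S"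
      then have "d < M" using that(1) R M by blast
      then show False using that(2) by simp
    qed
    obtain d where d: "(r, d) \<in> R" "c d = i" "M < d"
      using inf_i unfolding infinite_nat_iff_unbounded by blast
    have "\<forall>y\<in>F \<union> {..<N}. (y, d) \<notin> R" using r(2) d(1) trans sym by blast
    moreover have "c d' \<in> S" if "d \<le> d'" "(d', d) \<in> R" for d'
      using MS[of d'] trans[OF d(1) sym[OF that(2)]] that(1) d(3) by simp
    ultimately have "d \<in> B" using d R unfolding B_def tail_copy_def by blast
    then show ?thesis using \<open>\<forall>y\<in>F \<union> {..<N}. (y, d) \<notin> R\<close> by blast
  qed
  have "mono_copy_E D R c B"
    unfolding mono_copy_E_iff[OF pres] using B_inf B_new by (auto simp: B_def tail_copy_def)
  with S(1) show ?thesis unfolding B_def by blast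
qed

text \<open>\<open>excluded \<Delta> S i N p d\<close>: the instance computed by \<open>\<Delta>\<close> from \<open>p\<close> has \<open>d\<close> outside of its
  \<^const>\<open>tail_copy\<close>.  This is an open condition on \<open>p\<close>.\<close>

definition excluded :: "program \<Rightarrow> nat set \<Rightarrow> nat \<Rightarrow> nat \<Rightarrow> (nat \<Rightarrow> nat) \<Rightarrow> nat \<Rightarrow> bool" where
  "excluded \<Delta> S i N p d \<longleftrightarrow> eval p \<Delta> [4 * d] 0 \<or> (\<exists>v. v \<noteq> i \<and> eval p \<Delta> [2 * d + 1] v) \<or>
    (\<exists>e<N. eval p \<Delta> [4 * prod_encode (e, d) + 2] 1) \<or>
    (\<exists>d'\<ge>d. \<exists>v. v \<notin> S \<and> eval p \<Delta> [4 * prod_encode (d', d) + 2] 1 \<and> eval p \<Delta> [2 * d' + 1] v)"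

lemma excluded_use:
  assumes "excluded \<Delta> S i N p d"
  shows "\<exists>u. \<forall>q. (\<forall>n<u. q n = p n) \<longrightarrow> excluded \<Delta> S i N q d"
proof -
  consider "eval p \<Delta> [4 * d] 0"
    | v where "v \<noteq> i" "eval p \<Delta> [2 * d + 1] v"
    | e where "e < N" "eval p \<Delta> [4 * prod_encode (e, d) + 2] 1"
    | d' v where "d' \<ge> d" "v \<notin> S" "eval p \<Delta> [4 * prod_encode (d', d) + 2] 1" "eval p \<Delta> [2 * d' + 1] v"
    using assms unfolding excluded_def by blast
  then show ?thesis
  proof cases
    case 1
    from eval_use[OF this] show ?thesis unfolding excluded_def by blast
  next
    case 2
    from eval_use[OF this(2)] 2(1) show ?thesis unfolding excluded_def by blast
  next
    case 3
    from eval_use[OF this(2)] 3(1) show ?thesis unfolding excluded_def by blast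
  next
    case 4
    obtain u where u: "\<And>q. \<forall>n<u. q n = p n \<Longrightarrow> eval q \<Delta> [4 * prod_encode (d', d) + 2] 1"
      using eval_use[OF 4(3)] by blast
    obtain w where w: "\<And>q. \<forall>n<w. q n = p n \<Longrightarrow> eval q \<Delta> [2 * d' + 1] v"
      using eval_use[OF 4(4)] by blast
    have "excluded \<Delta> S i N q d" if "\<forall>n<max u w. q n = p n" for q
    proof -
      have "eval q \<Delta> [4 * prod_encode (d', d) + 2] 1" by (rule u) (use that in simp)
      moreover have "eval q \<Delta> [2 * d' + 1] v" by (rule w) (use that in simp)
      ultimately show ?thesis using 4(1,2) unfolding excluded_def by blast
    qed
    then show ?thesis by blast
  qed
qed

lemma excluded_iff:
  assumes "functional \<Delta> p (instance_name D R c)"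
  shows "excluded \<Delta> S i N p d \<longleftrightarrow> d \<notin> tail_copy D R c S i N"
proof -
  have ev: "eval p \<Delta> [n] v \<longleftrightarrow> instance_name D R c n = v" for n v
    using assms unfolding functional_def by (metis eval_deterministic)
  have "prod_encode x \<in> prod_encode ` R \<longleftrightarrow> x \<in> R" for x
    using inj_prod_encode[of UNIV] by (auto simp: inj_image_mem_iff)
  then show ?thesis
    unfolding excluded_def ev instance_name_nth tail_copy_def indicator_def by auto
qed

section \<open>Approximations by initial segments\<close>

definition truncate :: "nat \<Rightarrow> (nat \<Rightarrow> nat) \<Rightarrow> nat \<Rightarrow> nat" where
  "truncate s p m = (if Suc m < s then p m else 0)"

text \<open>A number is removed once every oracle with the given initial segment excludes it.
  Quantifying over all such oracles makes the set depend on the initial segment alone, without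
  counting computation steps.\<close>

definition included_at :: "program \<Rightarrow> nat set \<Rightarrow> nat \<Rightarrow> nat \<Rightarrow> nat \<Rightarrow> (nat \<Rightarrow> nat) \<Rightarrow> nat set" where
  "included_at \<Delta> S i N s p = {d. \<exists>q. truncate s q = truncate s p \<and> \<not> excluded \<Delta> S i N q d}"

lemma included_at_limit:
  assumes "functional \<Delta> p (instance_name D R c)"
  shows "\<exists>t. \<forall>s\<ge>t. d \<in> included_at \<Delta> S i N s p \<longleftrightarrow> d \<in> tail_copy D R c S i N"
proof (cases "excluded \<Delta> S i N p d")
  case True
  obtain u where u: "\<And>q. \<forall>n<u. q n = p n \<Longrightarrow> excluded \<Delta> S i N q d" using excluded_use[OF True] by blast
  have "d \<notin> included_at \<Delta> S i N s p" if s: "s \<ge> Suc u" for s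
  proof -
    have "q n = p n" if "truncate s q = truncate s p" "n < u" for q n
      using fun_cong[OF that(1), of n] that(2) s unfolding truncate_def by simp
    then show ?thesis unfolding included_at_def using u by blast
  qed
  then show ?thesis using True excluded_iff[OF assms] by blast
next
  case False
  then show ?thesis using excluded_iff[OF assms] unfolding included_at_def by blast
qed

definition approximation :: "program \<times> nat list \<times> nat \<times> nat \<times> program \<Rightarrow> nat \<Rightarrow> (nat \<Rightarrow> nat) \<Rightarrow> nat set" where
  "approximation = (\<lambda>(\<Delta>, S, i, N, \<Psi>) s p.
    {x. eval (truncate s p \<oplus>\<^sub>J indicator (included_at \<Delta> (set S) i N s p)) \<Psi> [x] 1})"

text \<open>The computation of \<open>\<Psi>\<close> at \<open>x\<close> looks at finitely many
  positions, and on these the truncated name and the approximated copy are eventually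
  correct.\<close>

lemma approximation_limit:
  assumes \<Delta>: "functional \<Delta> p (instance_name D R c)"
    and \<Psi>: "functional \<Psi> (p \<oplus>\<^sub>J indicator (tail_copy D R c (set S) i N)) (indicator H)"
  shows "\<exists>t. \<forall>s\<ge>t. x \<in> approximation (\<Delta>, S, i, N, \<Psi>) s p \<longleftrightarrow> x \<in> H"
proof -
  let ?B = "tail_copy D R c (set S) i N" and ?Bs = "\<lambda>s. included_at \<Delta> (set S) i N s p"
  have "eval (p \<oplus>\<^sub>J indicator ?B) \<Psi> [x] (indicator H x)" using \<Psi> unfolding functional_def by blast
  from eval_use[OF this] obtain u where
    u: "\<And>q. \<forall>n<u. q n = (p \<oplus>\<^sub>J indicator ?B) n \<Longrightarrow> eval q \<Psi> [x] (indicator H x)" by blast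
  obtain t where t: "\<And>d s. s \<ge> t d \<Longrightarrow> d \<in> ?Bs s \<longleftrightarrow> d \<in> ?B"
    using included_at_limit[OF \<Delta>, of _ "set S" i N] by metis
  obtain T where T: "\<forall>n\<in>t ` {..<u}. n < T" using finite_nat_set_iff_bounded[of "t ` {..<u}"] by auto
  have "x \<in> approximation (\<Delta>, S, i, N, \<Psi>) s p \<longleftrightarrow> x \<in> H" if s: "s \<ge> max T (Suc u)" for s
  proof -
    have "\<forall>n<u. truncate s p n = p n" using s unfolding truncate_def by simp
    moreover have "t n \<le> s" if "n < u" for n using T s that by (auto intro: less_imp_le less_le_trans)
    then have "\<forall>n<u. indicator (?Bs s) n = (indicator ?B n :: nat)"
      using t by (simp add: indicator_def)
    ultimately have ev: "eval (truncate s p \<oplus>\<^sub>J indicator (?Bs s)) \<Psi> [x] (indicator H x)"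
      using join_agree by (intro u) blast
    show ?thesis
    proof (cases "x \<in> H")
      case True
      then show ?thesis using ev unfolding approximation_def by simp
    next
      case False
      then show ?thesis using eval_deterministic[OF ev, of 1] unfolding approximation_def by auto
    qed
  qed
  then show ?thesis by blast
qed

theorem RT2_not_le_Ind_E_N: "\<not> RT2 2 \<le>\<^sub>c Ind_E_N"
proof
  assume red: "RT2 2 \<le>\<^sub>c Ind_E_N"
  have "approximation z s p = approximation z s q" if "\<forall>n. Suc n < s \<longrightarrow> p n = q n" for z s p q
  proof -
    have "truncate s p = truncate s q" using that unfolding truncate_def by auto
    then show ?thesis unfolding approximation_def included_at_def by (simp split: prod.split)
  qed
  \<comment> \<open>The parameters of an approximation, programs included, form a countable type, so
    \<open>from_nat e\<close> runs through all of them.\<close>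
  then obtain p where p2: "\<And>n. p n < 2" and diag: "\<And>e A j. infinite A \<Longrightarrow>
    \<forall>x. \<exists>t. \<forall>s\<ge>t. x \<in> approximation (from_nat e) s p \<longleftrightarrow> x \<in> A \<Longrightarrow> \<not> mono_pairs p j A"
    using diagonal_coloring[of "\<lambda>e. approximation (from_nat e)"] by blast
  define c where "c e = pair_color p (Min e) (Max e)" for e
  have name: "coloring_name c = p"
  proof
    fix n
    obtain i j where "prod_decode n = (i, j)" by force
    then have "prod_encode (i, j) = n" by (metis prod_decode_inverse)
    with \<open>prod_decode n = (i, j)\<close> show "coloring_name c n = p n"
      unfolding coloring_name_def c_def pair_color_def by simp
  qed
  have "c \<in> [UNIV]\<^bsup>2\<^esup> \<rightarrow> {..<2}" unfolding c_def pair_color_def using p2 by simp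
  then have "p \<in> Domain (RT2 2)" unfolding Domain_RT2 using name by blast
  then obtain y where y: "y \<in> Domain Ind_E_N" "computes p y"
    "\<And>q. q \<in> Ind_E_N `` {y} \<Longrightarrow> \<exists>z\<in>RT2 2 `` {p}. computes (p \<oplus>\<^sub>J q) z"
    using red unfolding computable_le_def by blast
  from y(1) obtain D R d where inst: "y = instance_name D R d" "presentation_E D R" "finite (d ` D)"
    unfolding Domain_Ind_E_N by blast
  from tail_copy_solution[OF inst(2,3)] obtain S i N where
    S: "finite S" "mono_copy_E D R d (tail_copy D R d S i N)" by blast
  \<comment> \<open>A list replaces the finite set \<open>S\<close>, since the parameters are to be
    taken from a countable type.\<close>
  obtain S' where S': "set S' = S" using finite_list[OF S(1)] by blast
  have "indicator (tail_copy D R d S i N) \<in> Ind_E_N `` {y}"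
    unfolding Ind_E_N_def using inst S(2) by blast
  then obtain z where z: "(p, z) \<in> RT2 2" "computes (p \<oplus>\<^sub>J indicator (tail_copy D R d S i N)) z"
    using y(3) by blast
  obtain c' H where H: "p = coloring_name c'" "z = indicator H" "infinite H" "homogeneous c' H"
    using z(1) unfolding RT2_def by blast
  obtain \<Delta> \<Psi> where \<Delta>: "functional \<Delta> p (instance_name D R d)"
    and \<Psi>: "functional \<Psi> (p \<oplus>\<^sub>J indicator (tail_copy D R d (set S') i N)) (indicator H)"
    using y(2) z(2) inst(1) H(2) S' unfolding computes_def by blast
  have "\<exists>t. \<forall>s\<ge>t. x \<in> approximation (from_nat (to_nat (\<Delta>, S', i, N, \<Psi>))) s p \<longleftrightarrow> x \<in> H" for x
    using approximation_limit[OF \<Delta> \<Psi>] by simp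
  then have "\<not> mono_pairs p j H" for j using diag[OF H(3)] by blast
  then show False using H(1,4) homogeneous_iff_mono_pairs by blast
qed

section \<open>Locking classes\<close>

text \<open>Elements with the same limit color can be added one at a time, far enough out.\<close>

lemma mono_pairs_extend:
  assumes X: "infinite X" "\<And>n. n \<in> X \<Longrightarrow> limit_color x n j"
    and F: "F \<subseteq> X" "finite F" "mono_pairs x j F"
  shows "\<exists>H. F \<subseteq> H \<and> H \<subseteq> X \<and> infinite H \<and> mono_pairs x j H \<and> (\<forall>h\<in>H. h < u \<longrightarrow> h \<in> F)"
proof -
  \<comment> \<open>The clause \<open>n \<le> card G\<close> makes the union of the chain infinite,
    and the last clause keeps new elements at or above \<open>u\<close>.\<close>
  define good where "good n G \<longleftrightarrow> F \<subseteq> G \<and> G \<subseteq> X \<and> finite G \<and> n \<le> card G \<and> mono_pairs x j G \<and>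
      (\<forall>h\<in>G. h < u \<longrightarrow> h \<in> F)" for n and G :: "nat set"
  have "\<exists>G'. good (Suc n) G' \<and> G \<subseteq> G'" if G: "good n G" for n G
  proof -
    have "\<exists>N. \<forall>b\<ge>N. \<forall>a\<in>G. pair_color x a b = j"
    proof -
      have "\<forall>a. \<exists>N. a \<in> G \<longrightarrow> (\<forall>b\<ge>N. pair_color x a b = j)"
        using G X(2) unfolding good_def limit_color_def by blast
      then obtain N where N: "\<And>a b. a \<in> G \<Longrightarrow> b \<ge> N a \<Longrightarrow> pair_color x a b = j" by metis
      obtain M where "\<forall>n\<in>N ` G. n < M"
        using G finite_nat_set_iff_bounded[of "N ` G"] unfolding good_def by blast
      then show ?thesis using N by (intro exI[of _ M]) fastforce
    qed
    then obtain N where N: "\<And>a b. a \<in> G \<Longrightarrow> b \<ge> N \<Longrightarrow> pair_color x a b = j" by blast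
    obtain M where M: "\<forall>n\<in>G. n < M"
      using G finite_nat_set_iff_bounded[of G] unfolding good_def by blast
    obtain y where y: "y \<in> X" "y > max u (max N M)" using X(1) infinite_nat_iff_unbounded by blast
    have "y \<notin> G" using M y by auto
    then have "good (Suc n) (insert y G)"
      using G y N M unfolding good_def mono_pairs_def by (auto dest: order.strict_trans)
    then show ?thesis by blast
  qed
  moreover have "good 0 F" using F unfolding good_def by simp
  ultimately obtain G where G: "\<And>n. good n (G n)" and step: "\<And>n. G n \<subseteq> G (Suc n)"
    using dependent_nat_choice[of good "\<lambda>_ G G'. G \<subseteq> G'"] by metis
  have mono: "G m \<subseteq> G n" if "m \<le> n" for m n using that by (rule lift_Suc_mono_le[of G, OF step])
  define H where "H = (\<Union>n. G n)"
  have "infinite H"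
  proof
    assume "finite H"
    then have "card (G n) \<le> card H" for n by (rule card_mono) (auto simp: H_def)
    then show False using G[of "Suc (card H)"] unfolding good_def by (meson not_less_eq_eq order_trans)
  qed
  moreover have "mono_pairs x j H"
    unfolding mono_pairs_def
  proof (intro ballI impI)
    fix a b assume "a \<in> H" "b \<in> H" "a < b"
    then obtain m n where "a \<in> G m" "b \<in> G n" unfolding H_def by blast
    then have "a \<in> G (max m n)" "b \<in> G (max m n)" using mono[of m "max m n"] mono[of n "max m n"] by auto
    then show "pair_color x a b = j" using G \<open>a < b\<close> unfolding good_def mono_pairs_def by blast
  qed
  ultimately show ?thesis
    using G unfolding good_def H_def by (intro exI[of _ "\<Union>n. G n"]) blast
qed

section \<open>Category arguments in Cantor space\<close>

definition binary_seqs :: "(nat \<Rightarrow> nat) set" where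
  "binary_seqs = {c. \<forall>n. c n < 2}"

text \<open>For finite \<open>A\<close> this is a basic open set of Cantor space. Later
  \<open>A\<close> also contains whole columns; the result is a closed subspace, in which genericity
  is then taken.\<close>

definition extensions :: "(nat \<Rightarrow> nat) \<Rightarrow> nat set \<Rightarrow> (nat \<Rightarrow> nat) set" where
  "extensions c A = {d \<in> binary_seqs. \<forall>n\<in>A. d n = c n}"

text \<open>\<open>T n d s\<close> expresses that the \<open>n\<close>-th requirement is forced by the first \<open>s\<close> values of \<open>d\<close>.\<close>

lemma generic_extension:
  fixes T :: "nat \<Rightarrow> (nat \<Rightarrow> nat) \<Rightarrow> nat \<Rightarrow> bool"
  assumes c: "c \<in> binary_seqs"
    and dense: "\<And>n d s. d \<in> extensions c A \<Longrightarrow> \<exists>e\<in>extensions d (A \<union> {..<s}). \<exists>s'. T n e s'"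
    and mono: "\<And>n d s s'. T n d s \<Longrightarrow> s \<le> s' \<Longrightarrow> T n d s'"
  shows "\<exists>g\<in>extensions c A. \<forall>n. \<exists>s. \<exists>d\<in>extensions c A. T n d s \<and> (\<forall>m<s. g m = d m)"
proof -
  \<comment> \<open>A condition is a sequence together with the length of its committed initial
    segment; the clause \<open>n \<le> snd z\<close> makes these lengths unbounded, so that the
    limit is total.\<close>
  define P where "P n z \<longleftrightarrow> fst z \<in> extensions c A \<and> n \<le> snd z \<and> T n (fst z) (snd z)"
    for n and z :: "(nat \<Rightarrow> nat) \<times> nat"
  define Q where "Q z z' \<longleftrightarrow> (\<forall>m<snd z. fst z' m = fst z m) \<and> snd z \<le> snd z'"
    for z z' :: "(nat \<Rightarrow> nat) \<times> nat"
  have "c \<in> extensions c A" using c unfolding extensions_def by simp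
  then obtain e s where "e \<in> extensions c A" "T 0 e s"
    using dense[of c 0 0] unfolding extensions_def by auto
  then have "P 0 (e, s)" unfolding P_def by simp
  moreover have "\<exists>z'. P (Suc n) z' \<and> Q z z'" if z: "P n z" for n z
  proof -
    obtain e s' where e: "e \<in> extensions (fst z) (A \<union> {..<snd z})" "T (Suc n) e s'"
      using dense[of "fst z" "snd z" "Suc n"] z unfolding P_def by blast
    then have "P (Suc n) (e, max s' (max (snd z) (Suc n)))" "Q z (e, max s' (max (snd z) (Suc n)))"
      using z mono[of "Suc n" e s'] unfolding P_def Q_def extensions_def by auto
    then show ?thesis by blast
  qed
  ultimately obtain f where f: "\<And>n. P n (f n)" and step: "\<And>n. Q (f n) (f (Suc n))"
    using dependent_nat_choice[of P "\<lambda>_. Q"] by metis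
  have Q: "Q (f m) (f n)" if "m \<le> n" for m n
    using that
  proof (induction n rule: dec_induct)
    case base
    show ?case unfolding Q_def by simp
  next
    case (step n)
    then show ?case using \<open>\<And>n. Q (f n) (f (Suc n))\<close>[of n] unfolding Q_def by simp
  qed
  \<comment> \<open>At stage \<open>Suc m\<close> at least \<open>Suc m\<close> values are
    committed, so the value at \<open>m\<close> is final there.\<close>
  define g where "g m = fst (f (Suc m)) m" for m
  have g: "g m = fst (f n) m" if "m < snd (f n)" for m n
  proof -
    have "m < snd (f (Suc m))" using f[of "Suc m"] unfolding P_def by simp
    then show ?thesis
      using Q[of n "Suc m"] Q[of "Suc m" n] that unfolding g_def Q_def by (cases "n \<le> Suc m") auto
  qed
  have "g \<in> extensions c A"
    using f unfolding P_def extensions_def binary_seqs_def g_def by simp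
  moreover have "\<exists>s. \<exists>d\<in>extensions c A. T n d s \<and> (\<forall>m<s. g m = d m)" for n
    using f[of n] g unfolding P_def by blast
  ultimately show ?thesis by blast
qed

text \<open>The Baire category theorem in the subspace \<open>extensions c A\<close>: if countably
  many closed sets cover it, one of them contains a neighborhood. Otherwise a generic point would
  escape them all.\<close>

lemma baire_extension:
  assumes c: "c \<in> binary_seqs"
    and closed: "\<And>n d. d \<in> binary_seqs \<Longrightarrow> \<not> Q n d \<Longrightarrow>
      \<exists>s. \<forall>e\<in>binary_seqs. (\<forall>m<s. e m = d m) \<longrightarrow> \<not> Q n e"
    and cover: "\<And>d. d \<in> extensions c A \<Longrightarrow> \<exists>n. Q (n :: nat) d"
  shows "\<exists>d\<in>extensions c A. \<exists>s n. \<forall>e\<in>extensions d (A \<union> {..<s}). Q n e"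
proof (rule ccontr)
  assume neg: "\<not> ?thesis"
  have "\<exists>g\<in>extensions c A. \<forall>n. \<exists>s. \<exists>d\<in>extensions c A.
      (\<forall>e\<in>binary_seqs. (\<forall>m<s. e m = d m) \<longrightarrow> \<not> Q n e) \<and> (\<forall>m<s. g m = d m)"
  proof (rule generic_extension[OF c])
    fix n d s assume "d \<in> extensions c A"
    then obtain e where e: "e \<in> extensions d (A \<union> {..<s})" "\<not> Q n e" using neg by blast
    then show "\<exists>e\<in>extensions d (A \<union> {..<s}). \<exists>s'. \<forall>e'\<in>binary_seqs. (\<forall>m<s'. e' m = e m) \<longrightarrow> \<not> Q n e'"
      using closed[of e n] unfolding extensions_def by blast
  qed (meson order.strict_trans2)
  then obtain g where g: "g \<in> extensions c A" "\<And>n. \<not> Q n g" unfolding extensions_def by blast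
  then show False using cover by blast
qed

text \<open>\<open>X c\<close> is the name of a coloring of pairs assigned to the coloring \<open>c\<close> of the standard presentation, and
  \<open>Y c H\<close> the solution obtained from the homogeneous set \<open>H\<close>.  After a finite part and finitely many columns have been fixed, a generic
  extension has all its limit colors forced.  If \<open>b\<close> is put into the solution because of a finite set
  of limit color \<open>j\<close>, then turning the rest of the column of \<open>b\<close> into the other color makes it
  impossible for infinitely many points to have limit color \<open>j\<close>.  So the limit colors run out.\<close>

lemma no_continuous_reduction:
  fixes X :: "(nat \<Rightarrow> nat) \<Rightarrow> nat \<Rightarrow> nat" and Y :: "(nat \<Rightarrow> nat) \<Rightarrow> nat set \<Rightarrow> nat set"
  assumes X_cont: "\<And>c n. c \<in> binary_seqs \<Longrightarrow>
      \<exists>s. \<forall>d\<in>binary_seqs. (\<forall>m<s. d m = c m) \<longrightarrow> X d n = X c n"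
    and X_lim: "\<And>c n. c \<in> binary_seqs \<Longrightarrow> \<exists>j. limit_color (X c) n j"
    and X_bound: "\<And>c. c \<in> binary_seqs \<Longrightarrow> \<exists>k. \<forall>m. X c m < k"
    and Y_sol: "\<And>c H j. c \<in> binary_seqs \<Longrightarrow> infinite H \<Longrightarrow> mono_pairs (X c) j H \<Longrightarrow>
      mono_copy_E UNIV standard_rel c (Y c H)"
    and Y_cont: "\<And>c H j b. c \<in> binary_seqs \<Longrightarrow> infinite H \<Longrightarrow> mono_pairs (X c) j H \<Longrightarrow> b \<in> Y c H \<Longrightarrow>
      \<exists>u. \<forall>d\<in>binary_seqs. \<forall>H'. infinite H' \<longrightarrow> mono_pairs (X d) j H' \<longrightarrow>
        (\<forall>m<u. d m = c m) \<longrightarrow> H' \<inter> {..<u} = H \<inter> {..<u} \<longrightarrow> b \<in> Y d H'"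
  shows False
proof -
  have pair_cont: "\<exists>s. \<forall>d\<in>binary_seqs. (\<forall>m<s. d m = c m) \<longrightarrow> pair_color (X d) a b = pair_color (X c) a b"
    if "c \<in> binary_seqs" for c a b
    using X_cont[OF that] unfolding pair_color_def by blast
  have decide: "\<exists>d\<in>extensions c (A \<union> {..<s}). \<exists>s' j. \<forall>e\<in>extensions d (A \<union> {..<s'}). limit_color (X e) n j"
    if c: "c \<in> binary_seqs" for c A s n
  proof -
    \<comment> \<open>\<open>z\<close> codes a limit color and a place from which on it is attained.
      For each \<open>z\<close> this is a closed condition on \<open>d\<close>, and by stability
      these conditions cover the space.\<close>
    define Q where "Q z d \<longleftrightarrow> (\<forall>b\<ge>fst (prod_decode z). pair_color (X d) n b = snd (prod_decode z))" for z d
    have "\<exists>d\<in>extensions c (A \<union> {..<s}). \<exists>s' z. \<forall>e\<in>extensions d (A \<union> {..<s} \<union> {..<s'}). Q z e"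
    proof (rule baire_extension[OF c])
      fix z d assume d: "d \<in> binary_seqs" "\<not> Q z d"
      then obtain b where "b \<ge> fst (prod_decode z)" "pair_color (X d) n b \<noteq> snd (prod_decode z)"
        unfolding Q_def by blast
      then show "\<exists>s. \<forall>e\<in>binary_seqs. (\<forall>m<s. e m = d m) \<longrightarrow> \<not> Q z e"
        using pair_cont[OF d(1), of n b] unfolding Q_def by metis
    next
      fix d assume "d \<in> extensions c (A \<union> {..<s})"
      then have "\<exists>j. limit_color (X d) n j" using X_lim unfolding extensions_def by simp
      then obtain N j where "\<forall>b\<ge>N. pair_color (X d) n b = j" unfolding limit_color_def by blast
      then have "Q (prod_encode (N, j)) d" unfolding Q_def by simp
      then show "\<exists>z. Q z d" ..
    qed
    then obtain d s' z where d: "d \<in> extensions c (A \<union> {..<s})"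
      "\<forall>e\<in>extensions d (A \<union> {..<s} \<union> {..<s'}). Q z e" by blast
    have "A \<union> {..<s} \<union> {..<s'} = A \<union> {..<max s s'}" by auto
    then show ?thesis using d unfolding Q_def limit_color_def by metis
  qed
  \<comment> \<open>Deciding the limit color of a single \<open>n\<close> is dense, so one sequence
    has all its limit colors decided by \<open>A\<close> and finite parts.\<close>
  have generic: "\<exists>g\<in>extensions c A. \<forall>n. \<exists>s j. \<forall>e\<in>extensions g (A \<union> {..<s}). limit_color (X e) n j"
    if c: "c \<in> binary_seqs" for c A
  proof -
    have "\<exists>g\<in>extensions c A. \<forall>n. \<exists>s. \<exists>d\<in>extensions c A.
        (\<exists>j. \<forall>e\<in>extensions d (A \<union> {..<s}). limit_color (X e) n j) \<and> (\<forall>m<s. g m = d m)"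
    proof (rule generic_extension[OF c])
      fix n d s s'
      assume "\<exists>j. \<forall>e\<in>extensions d (A \<union> {..<s}). limit_color (X e) n j" "s \<le> s'"
      then show "\<exists>j. \<forall>e\<in>extensions d (A \<union> {..<s'}). limit_color (X e) n j"
        unfolding extensions_def by fastforce
    qed (use decide in \<open>auto simp: extensions_def\<close>)
    then obtain g where g: "g \<in> extensions c A" and dec: "\<And>n. \<exists>s. \<exists>d\<in>extensions c A.
        (\<exists>j. \<forall>e\<in>extensions d (A \<union> {..<s}). limit_color (X e) n j) \<and> (\<forall>m<s. g m = d m)" by blast
    have "\<exists>s j. \<forall>e\<in>extensions g (A \<union> {..<s}). limit_color (X e) n j" for n
    proof -
      obtain s d j where d: "d \<in> extensions c A" "\<forall>e\<in>extensions d (A \<union> {..<s}). limit_color (X e) n j"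
        "\<forall>m<s. g m = d m" using dec by blast
      have "extensions g (A \<union> {..<s}) \<subseteq> extensions d (A \<union> {..<s})"
        using d(1,3) g unfolding extensions_def by auto
      then show ?thesis using d(2) by blast
    qed
    with g show ?thesis by blast
  qed
  define cols where "cols V = {n. fst (prod_decode n) \<in> V}" for V
  \<comment> \<open>\<open>K\<close> contains the limit colors that any extension can attain
    infinitely often. Each round fixes one more column and removes a color from
    \<open>K\<close>.\<close>
  have no_colors: False
    if "finite K" "c \<in> binary_seqs" "finite V"
      "\<And>d j. d \<in> extensions c ({..<s} \<union> cols V) \<Longrightarrow> infinite {n. limit_color (X d) n j} \<Longrightarrow> j \<in> K"
    for K c V s
    using that
  proof (induction K arbitrary: c V s rule: finite_psubset_induct)
    case (psubset K)
    define A where "A = {..<s} \<union> cols V"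
    obtain g where g: "g \<in> extensions c A"
      and dec: "\<And>n. \<exists>s j. \<forall>e\<in>extensions g (A \<union> {..<s}). limit_color (X e) n j"
      using generic[OF psubset.prems(1)] by blast
    have g2: "g \<in> binary_seqs" using g unfolding extensions_def by simp
    obtain j where j: "infinite {n. limit_color (X g) n j}"
    proof -
      obtain k where k: "\<And>m. X g m < k" using X_bound[OF g2] by blast
      have "n \<in> (\<Union>j\<in>{..<k}. {n. limit_color (X g) n j})" for n
      proof -
        obtain j where j: "limit_color (X g) n j" using X_lim[OF g2] by blast
        then have "j < k" using k unfolding limit_color_def pair_color_def by blast
        with j show ?thesis by blast
      qed
      then have "infinite (\<Union>j\<in>{..<k}. {n. limit_color (X g) n j})"
        using infinite_super[OF _ infinite_UNIV_nat] by blast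
      then show ?thesis using that by auto
    qed
    then have "j \<in> K" using psubset.prems(3)[of g] g unfolding A_def by blast
    obtain H where H: "infinite H" "mono_pairs (X g) j H" "\<And>n. n \<in> H \<Longrightarrow> limit_color (X g) n j"
      using mono_pairs_extend[OF j, of "X g" j "{}" 0] unfolding mono_pairs_def by auto
    note copy = Y_sol[OF g2 H(1,2), unfolded mono_copy_E_iff[OF presentation_standard]]
    have "finite ((\<lambda>v. prod_encode (v, 0)) ` V)" using psubset.prems(2) by simp
    \<comment> \<open>The copy meets infinitely many columns, so it has a point outside of the
      finitely many fixed ones. In the column of this point only positions below \<open>s\<close>
      are committed.\<close>
    then obtain b where b: "b \<in> Y g H" "\<forall>y\<in>(\<lambda>v. prod_encode (v, 0)) ` V. (y, b) \<notin> standard_rel"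
      using copy by blast
    define x where "x = fst (prod_decode b)"
    have "x \<notin> V" using b(2) unfolding standard_rel_def x_def by auto
    obtain u where u: "\<And>d H'. d \<in> binary_seqs \<Longrightarrow> infinite H' \<Longrightarrow> mono_pairs (X d) j H' \<Longrightarrow>
        \<forall>m<u. d m = g m \<Longrightarrow> H' \<inter> {..<u} = H \<inter> {..<u} \<Longrightarrow> b \<in> Y d H'"
      using Y_cont[OF g2 H(1,2) b(1)] by blast
    define F where "F = H \<inter> {..<u}"
    \<comment> \<open>Together with \<open>A\<close>, the values of \<open>g\<close> below
      \<open>t\<close> force \<open>F\<close> to be homogeneous with limit color \<open>j\<close>;
      they also include the use \<open>u\<close> and the color of \<open>b\<close>.\<close>
    obtain t where t: "\<And>d n. d \<in> extensions g (A \<union> {..<t}) \<Longrightarrow> n \<in> F \<Longrightarrow> limit_color (X d) n j"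
      "\<And>d. d \<in> extensions g (A \<union> {..<t}) \<Longrightarrow> mono_pairs (X d) j F" "s \<le> t" "u \<le> t" "b < t"
    proof -
      have "\<forall>n. \<exists>s. n \<in> F \<longrightarrow> (\<forall>d\<in>extensions g (A \<union> {..<s}). limit_color (X d) n j)"
      proof
        fix n
        obtain s j' where s: "\<forall>e\<in>extensions g (A \<union> {..<s}). limit_color (X e) n j'" using dec by blast
        have "g \<in> extensions g (A \<union> {..<s})" using g2 unfolding extensions_def by simp
        then have "n \<in> F \<Longrightarrow> j' = j" using s H(3)[of n] limit_color_unique unfolding F_def by blast
        with s show "\<exists>s. n \<in> F \<longrightarrow> (\<forall>d\<in>extensions g (A \<union> {..<s}). limit_color (X d) n j)" by blast
      qed
      then obtain S where S: "\<And>n d. n \<in> F \<Longrightarrow> d \<in> extensions g (A \<union> {..<S n}) \<Longrightarrow> limit_color (X d) n j"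
        by metis
      obtain W where W: "\<And>a b d. d \<in> binary_seqs \<Longrightarrow> \<forall>m<W a b. d m = g m \<Longrightarrow>
          pair_color (X d) a b = pair_color (X g) a b"
        using pair_cont[OF g2] by metis
      have "finite F" unfolding F_def by simp
      then have "finite (S ` F \<union> (\<lambda>(a, b). W a b) ` (F \<times> F))" by simp
      then obtain t where t: "\<forall>n\<in>S ` F \<union> (\<lambda>(a, b). W a b) ` (F \<times> F). n < t"
        unfolding finite_nat_set_iff_bounded by blast
      define r where "r = max t (max s (max u (Suc b)))"
      show ?thesis
      proof (rule that[of r])
        fix d assume d: "d \<in> extensions g (A \<union> {..<r})"
        show "limit_color (X d) n j" if "n \<in> F" for n
        proof (rule S[OF that])
          have "S n < t" using t that by blast
          then have "S n \<le> r" unfolding r_def by simp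
          then show "d \<in> extensions g (A \<union> {..<S n})" using d unfolding extensions_def by auto
        qed
        show "mono_pairs (X d) j F"
          unfolding mono_pairs_def
        proof (intro ballI impI)
          fix a b assume ab: "a \<in> F" "b \<in> F" "a < b"
          then have "W a b < t" using t by blast
          then have "W a b \<le> r" unfolding r_def by simp
          then have "pair_color (X d) a b = pair_color (X g) a b"
            using d by (intro W) (auto simp: extensions_def)
          then show "pair_color (X d) a b = j" using H(2) ab unfolding mono_pairs_def F_def by simp
        qed
      qed (auto simp: r_def)
    qed
    \<comment> \<open>From \<open>t\<close> on the column of \<open>b\<close> receives the color
      other than that of \<open>b\<close>, which is \<open>1 - g b\<close> as only 0 and 1 occur.
      Since \<open>x \<notin> V\<close>, the columns fixed earlier are left alone.\<close>
    define c' where "c' n = (if fst (prod_decode n) = x \<and> t \<le> n then 1 - g b else g n)" for n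
    have c': "c' \<in> binary_seqs" using g2 unfolding c'_def binary_seqs_def by (simp add: less_Suc_eq_le numeral_2_eq_2)
    have sub: "d \<in> extensions g (A \<union> {..<t})" if "d \<in> extensions c' ({..<t} \<union> cols (insert x V))" for d
      using that \<open>x \<notin> V\<close> t(3) unfolding extensions_def A_def cols_def c'_def by auto
    \<comment> \<open>If infinitely many numbers kept limit color \<open>j\<close>, then
      \<open>F\<close> would extend to a homogeneous set agreeing with \<open>H\<close> below
      \<open>u\<close>. So \<open>b\<close> would be in the solution, although its column has only
      finitely many points of its color.\<close>
    have dead: False if d: "d \<in> extensions c' ({..<t} \<union> cols (insert x V))"
      and inf: "infinite {n. limit_color (X d) n j}" for d
    proof -
      have d2: "d \<in> binary_seqs" using d unfolding extensions_def by simp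
      have "F \<subseteq> {n. limit_color (X d) n j}" using t(1) sub[OF d] by blast
      moreover have "finite F" unfolding F_def by simp
      ultimately obtain H' where H': "F \<subseteq> H'" "infinite H'" "mono_pairs (X d) j H'" "\<forall>h\<in>H'. h < u \<longrightarrow> h \<in> F"
        using mono_pairs_extend[OF inf, of "X d" j F u] t(2)[OF sub[OF d]] by blast
      have "H' \<inter> {..<u} = H \<inter> {..<u}" using H'(1,4) unfolding F_def by auto
      moreover have dg: "d m = g m" if "m < t" for m
        using that sub[OF d] unfolding extensions_def by simp
      ultimately have bY: "b \<in> Y d H'" using u[OF d2 H'(2,3)] t(4) by simp
      note copy' = Y_sol[OF d2 H'(2,3), unfolded mono_copy_E_iff[OF presentation_standard]]
      have "{y \<in> Y d H'. (b, y) \<in> standard_rel} \<subseteq> {..<t}"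
      proof (rule subsetI, rule ccontr)
        fix y assume y: "y \<in> {y \<in> Y d H'. (b, y) \<in> standard_rel}" "y \<notin> {..<t}"
        then have "fst (prod_decode y) = x" unfolding standard_rel_def x_def by simp
        then have "d y = 1 - g b" using d y(2) unfolding extensions_def cols_def c'_def by simp
        moreover have "d y = d b" using copy' y(1) bY by (metis (no_types, lifting) mem_Collect_eq)
        moreover have "g b < 2" using g2 unfolding binary_seqs_def by simp
        ultimately show False using dg[OF t(5)] by arith
      qed
      then have "finite {y \<in> Y d H'. (b, y) \<in> standard_rel}" by (rule finite_subset) simp
      then show False using bspec[OF conjunct1[OF conjunct2[OF conjunct2[OF copy']]] bY] by blast
    qed
    show False
    proof (rule psubset.IH)
      show "K - {j} \<subset> K" using \<open>j \<in> K\<close> by blast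
      show "c' \<in> binary_seqs" by (rule c')
      show "finite (insert x V)" using psubset.prems(2) by simp
      fix d j' assume d: "d \<in> extensions c' ({..<t} \<union> cols (insert x V))"
        and inf: "infinite {n. limit_color (X d) n j'}"
      have "d \<in> extensions c A" using sub[OF d] g unfolding extensions_def by auto
      then have "j' \<in> K" using psubset.prems(3) inf unfolding A_def by blast
      moreover have "j' \<noteq> j" using dead[OF d] inf by blast
      ultimately show "j' \<in> K - {j}" by blast
    qed
  qed
  have zero: "(\<lambda>_. 0) \<in> binary_seqs" unfolding binary_seqs_def by simp
  \<comment> \<open>The number of colors varies with the instance. By category some \<open>k\<close>
    works on a whole neighborhood, so the induction can start from the finite set
    \<open>{..<k}\<close>.\<close>
  have "\<exists>d\<in>extensions (\<lambda>_. 0) {}. \<exists>s k. \<forall>e\<in>extensions d ({} \<union> {..<s}). \<forall>m. X e m < k"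
  proof (rule baire_extension[OF zero])
    fix k d assume d: "d \<in> binary_seqs" "\<not> (\<forall>m. X d m < k)"
    then obtain m where "\<not> X d m < k" by blast
    then show "\<exists>s. \<forall>e\<in>binary_seqs. (\<forall>m<s. e m = d m) \<longrightarrow> \<not> (\<forall>m. X e m < k)"
      using X_cont[OF d(1), of m] by metis
  qed (use X_bound in \<open>auto simp: extensions_def\<close>)
  then obtain d s k where d: "d \<in> binary_seqs" and k: "\<And>e m. e \<in> extensions d ({} \<union> {..<s}) \<Longrightarrow> X e m < k"
    unfolding extensions_def[of _ "{}"] by blast
  show False
  proof (rule no_colors[of "{..<k}" d "{}" s])
    fix e j assume e: "e \<in> extensions d ({..<s} \<union> cols {})" and "infinite {n. limit_color (X e) n j}"
    then obtain n where "limit_color (X e) n j" using not_finite_existsD by auto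
    then obtain b where "pair_color (X e) n b = j" unfolding limit_color_def by blast
    moreover have "pair_color (X e) n b < k"
      using k e unfolding cols_def pair_color_def by simp
    ultimately show "j \<in> {..<k}" by simp
  qed (use d in auto)
qed

section \<open>Continuous maps from a uniform reduction\<close>

lemma SRT2_N_I:
  assumes "x \<in> Domain SRT2_N" "infinite H" "mono_pairs x j H"
  shows "(x, indicator H) \<in> SRT2_N"
proof -
  obtain c where c: "x = coloring_name c" "(\<exists>k. c \<in> [UNIV]\<^bsup>2\<^esup> \<rightarrow> {..<k}) \<and> stable_coloring c"
    using assms(1) unfolding Domain_SRT2_N by blast
  moreover have "homogeneous c H" using assms(3) c(1) homogeneous_iff_mono_pairs by blast
  ultimately show ?thesis using assms(2) unfolding SRT2_N_def by blast
qed

theorem Ind_E_not_le_SRT2_N: "\<not> Ind_E 2 \<le>\<^sub>W SRT2_N"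
proof
  assume "Ind_E 2 \<le>\<^sub>W SRT2_N"
  then obtain \<Delta> \<Psi> where red: "\<forall>p\<in>Domain (Ind_E 2). \<exists>x\<in>Domain SRT2_N. functional \<Delta> p x \<and>
      (\<forall>q\<in>SRT2_N `` {x}. \<exists>y\<in>Ind_E 2 `` {p}. functional \<Psi> (p \<oplus>\<^sub>J q) y)"
    unfolding weihrauch_le_def by blast
  define inst where "inst = instance_name UNIV standard_rel"
  have inst: "inst c \<in> Domain (Ind_E 2)" if "c \<in> binary_seqs" for c
    using that presentation_standard unfolding Domain_Ind_E inst_def binary_seqs_def by blast
  have inst_agree: "\<forall>m<u. inst d m = inst c m" if "\<forall>m<u. d m = c m" for u d c
    unfolding inst_def instance_name_def using that by (intro join_agree) auto
  define good where "good c x \<longleftrightarrow> x \<in> Domain SRT2_N \<and> functional \<Delta> (inst c) x \<and>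
      (\<forall>q\<in>SRT2_N `` {x}. \<exists>y\<in>Ind_E 2 `` {inst c}. functional \<Psi> (inst c \<oplus>\<^sub>J q) y)" for c x
  have "\<forall>c\<in>binary_seqs. \<exists>x. good c x"
    unfolding good_def using red inst by blast
  then obtain X where "\<forall>c\<in>binary_seqs. good c (X c)" using bchoice[of binary_seqs good] by blast
  then have X: "\<And>c. c \<in> binary_seqs \<Longrightarrow> X c \<in> Domain SRT2_N"
      "\<And>c. c \<in> binary_seqs \<Longrightarrow> functional \<Delta> (inst c) (X c)"
      "\<And>c q. c \<in> binary_seqs \<Longrightarrow> q \<in> SRT2_N `` {X c} \<Longrightarrow>
        \<exists>y\<in>Ind_E 2 `` {inst c}. functional \<Psi> (inst c \<oplus>\<^sub>J q) y"
    unfolding good_def by blast+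
  \<comment> \<open>Only the output 1 is asked for, so \<open>Y\<close> is defined for all
    \<open>H\<close> and a single halting computation puts a point into it. This makes membership an
    open condition.\<close>
  define Y where "Y c H = {b. eval (inst c \<oplus>\<^sub>J indicator H) \<Psi> [b] 1}" for c H
  have X_name: "\<exists>e k. X c = coloring_name e \<and> e \<in> [UNIV]\<^bsup>2\<^esup> \<rightarrow> {..<k} \<and> stable_coloring e"
    if "c \<in> binary_seqs" for c using X(1)[OF that] unfolding Domain_SRT2_N by blast
  show False
  proof (rule no_continuous_reduction[of X Y])
    fix c :: "nat \<Rightarrow> nat" and n assume c: "c \<in> binary_seqs"
    have "eval (inst c) \<Delta> [n] (X c n)" using X(2)[OF c] unfolding functional_def ..
    from eval_use[OF this] obtain u where u: "\<And>q. \<forall>n<u. q n = inst c n \<Longrightarrow> eval q \<Delta> [n] (X c n)" by blast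
    have "X d n = X c n" if "d \<in> binary_seqs" "\<forall>m<u. d m = c m" for d
      using u[OF inst_agree[OF that(2)]] X(2)[OF that(1)] eval_deterministic
      unfolding functional_def by blast
    then show "\<exists>s. \<forall>d\<in>binary_seqs. (\<forall>m<s. d m = c m) \<longrightarrow> X d n = X c n" by blast
    show "\<exists>j. limit_color (X c) n j" using X_name[OF c] stable_coloring_limit by auto
    show "\<exists>k. \<forall>m. X c m < k" using X_name[OF c] coloring_name_bound by metis
  next
    fix c H j assume c: "c \<in> binary_seqs" and H: "infinite H" "mono_pairs (X c) j H"
    have "indicator H \<in> SRT2_N `` {X c}" using SRT2_N_I[OF X(1)[OF c] H] by blast
    from X(3)[OF c this] obtain y where y: "(inst c, y) \<in> Ind_E 2"
      "functional \<Psi> (inst c \<oplus>\<^sub>J indicator H) y" by blast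
    from y(1) obtain B where B: "y = indicator B" "mono_copy_E UNIV standard_rel c B"
      unfolding Ind_E_def inst_def by (auto simp: instance_name_inject)
    have y_eval: "eval (inst c \<oplus>\<^sub>J indicator H) \<Psi> [b] (indicator B b)" for b
      using y(2) B(1) unfolding functional_def by blast
    have "eval (inst c \<oplus>\<^sub>J indicator H) \<Psi> [b] 1 \<longleftrightarrow> b \<in> B" for b
    proof
      assume "eval (inst c \<oplus>\<^sub>J indicator H) \<Psi> [b] 1"
      from eval_deterministic[OF this y_eval] show "b \<in> B" by (cases "b \<in> B") simp_all
    qed (use y_eval[of b] in simp)
    then have "Y c H = B" unfolding Y_def by simp
    then show "mono_copy_E UNIV standard_rel c (Y c H)" using B by simp
    fix b assume "b \<in> Y c H"
    then have "eval (inst c \<oplus>\<^sub>J indicator H) \<Psi> [b] 1" unfolding Y_def by simp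
    from eval_use[OF this] obtain u where
      u: "\<And>q. \<forall>n<u. q n = (inst c \<oplus>\<^sub>J indicator H) n \<Longrightarrow> eval q \<Psi> [b] 1" by blast
    have "b \<in> Y d H'" if "\<forall>m<u. d m = c m" "H' \<inter> {..<u} = H \<inter> {..<u}" for d H'
    proof -
      have "\<forall>m<u. indicator H' m = (indicator H m :: nat)" using that(2) by (auto simp: indicator_def)
      then show ?thesis using u[OF join_agree[OF inst_agree[OF that(1)]]] unfolding Y_def by blast
    qed
    then show "\<exists>u. \<forall>d\<in>binary_seqs. \<forall>H'. infinite H' \<longrightarrow> mono_pairs (X d) j H' \<longrightarrow>
        (\<forall>m<u. d m = c m) \<longrightarrow> H' \<inter> {..<u} = H \<inter> {..<u} \<longrightarrow> b \<in> Y d H'" by blast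
  qed
qed

theorem theorem5p1:
  shows "(\<forall>k::nat. k \<ge> 2 \<longrightarrow> SRT2 k \<le>\<^sub>W Ind_E k \<and> Ind_E k \<le>\<^sub>W RT2 k)
    \<and> \<not> RT2 2 \<le>\<^sub>c Ind_E_N
    \<and> \<not> Ind_E 2 \<le>\<^sub>W SRT2_N"
  using SRT2_le_Ind_E Ind_E_le_RT2 RT2_not_le_Ind_E_N Ind_E_not_le_SRT2_N by blast

end
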